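(* Let $G_1,G_2$ be finite groups. The following are equivalent: (i) the power graphs $\mathcal P_{G_1}$ and $\mathcal P_{G_2}$ are isomorphic; (ii) the power digraphs $\overrightarrow{\mathcal P}_{G_1}$ and $\overrightarrow{\mathcal P}_{G_2}$ are isomorphic; (iii) the digraphs $\mathcal O_{G_1}$ and $\mathcal O_{G_2}$ are isomorphic; (iv) the posets $L_{G_1}$ and $L_{G_2}$ are isomorphic; (v) there is an isomorphism $\tau$ from the poset $L_{G_1}/\mathcal C'(G_1)$ to the poset $L_{G_2}/\mathcal C'(G_2)$ such that $|\tau(S)|=|S|$ for each $S\in\mathcal C'(G_1)$.
   Context: For a finite group $G$: the power graph $\mathcal P_G$ has vertex set $G$, two distinct elements adjacent iff one is a power of the other; the power digraph $\overrightarrow{\mathcal P}_G$ has vertex set $G$ and an arc $x\to y$ iff $x\ne y$ and $y=x^m$ for some positive integer $m$. For $x\in G$, $[x]$ is the set of generators of $\langle x\rangle$, and $\mathcal C'(G)=\{[x]: x\in G\}$ (a partition of $G$). Fix for each member of $\mathcal C'(G)$ an arbitrary linear ordering. Define $x\prec y$ if either $x,y$ lie in the same member of $\mathcal C'(G)$ with $x$ preceding $y$, or $\langle x\rangle\subsetneqq\langle y\rangle$; and $x\preceq y$ iff $x\prec y$ or $x=y$. Then $L_G=(G,\preceq)$ is a poset, and $\mathcal O_G$ is the digraph on $G$ with an arc $x\to y$ iff $y\prec x$. The quotient poset $L_G/\mathcal C'(G)$ has element set $\mathcal C'(G)$, with $S_1\le S_2$ iff $S_1=S_2$ or $x\prec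 y$ for all $x\in S_1$, $y\in S_2$. *)

theory Defs
  imports
    "HOL-Algebra.Generated_Groups"
    "HOL-Algebra.Order"
    "Graph_Theory.Digraph_Isomorphism"
    "Graph_Theory.Pair_Digraph"
begin

definition is_power_of :: "('a, 'm) monoid_scheme \<Rightarrow> 'a \<Rightarrow> 'a \<Rightarrow> bool" where
  "is_power_of G y x \<longleftrightarrow> (\<exists>m::nat. m > 0 \<and> y = x [^]\<^bsub>G\<^esub> m)"

text \<open>Undirected graphs are symmetric digraphs, as in the locale \<^locale>\<open>pair_graph\<close>: an edge
  between \<open>x\<close> and \<open>y\<close> is the pair of arcs \<open>(x, y)\<close>, \<open>(y, x)\<close>.\<close>

definition power_graph :: "('a, 'm) monoid_scheme \<Rightarrow> 'a pair_pre_digraph" where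
  "power_graph G = \<lparr> pverts = carrier G,
     parcs = {(x, y). x \<in> carrier G \<and> y \<in> carrier G \<and> x \<noteq> y \<and>
                      (is_power_of G x y \<or> is_power_of G y x)} \<rparr>"

definition power_digraph :: "('a, 'm) monoid_scheme \<Rightarrow> 'a pair_pre_digraph" where
  "power_digraph G = \<lparr> pverts = carrier G,
     parcs = {(x, y). x \<in> carrier G \<and> y \<in> carrier G \<and> x \<noteq> y \<and> is_power_of G y x} \<rparr>"

definition cyclic_class :: "('a, 'm) monoid_scheme \<Rightarrow> 'a \<Rightarrow> 'a set" where
  "cyclic_class G x = {y \<in> generate G {x}. generate G {y} = generate G {x}}"

definition cyclic_classes :: "('a, 'm) monoid_scheme \<Rightarrow> 'a set set" where
  "cyclic_classes G = cyclic_class G ` carrier G"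

text \<open>The chosen (reflexive) linear order on a class \<open>S\<close> is \<open>r S\<close>.\<close>

definition class_ordering :: "('a, 'm) monoid_scheme \<Rightarrow> ('a set \<Rightarrow> 'a rel) \<Rightarrow> bool" where
  "class_ordering G r \<longleftrightarrow> (\<forall>S \<in> cyclic_classes G. linear_order_on S (r S))"

definition cyc_less :: "('a, 'm) monoid_scheme \<Rightarrow> ('a set \<Rightarrow> 'a rel) \<Rightarrow> 'a \<Rightarrow> 'a \<Rightarrow> bool" where
  "cyc_less G r x y \<longleftrightarrow>
     (\<exists>S \<in> cyclic_classes G. x \<in> S \<and> y \<in> S \<and> x \<noteq> y \<and> (x, y) \<in> r S) \<or>
     generate G {x} \<subset> generate G {y}"

definition cyc_poset :: "('a, 'm) monoid_scheme \<Rightarrow> ('a set \<Rightarrow> 'a rel) \<Rightarrow> 'a gorder" where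
  "cyc_poset G r = \<lparr> carrier = carrier G, eq = (=), le = (\<lambda>x y. cyc_less G r x y \<or> x = y) \<rparr>"

definition order_digraph :: "('a, 'm) monoid_scheme \<Rightarrow> ('a set \<Rightarrow> 'a rel) \<Rightarrow> 'a pair_pre_digraph" where
  "order_digraph G r = \<lparr> pverts = carrier G,
     parcs = {(x, y). x \<in> carrier G \<and> y \<in> carrier G \<and> cyc_less G r y x} \<rparr>"

definition quotient_poset :: "('a, 'm) monoid_scheme \<Rightarrow> ('a set \<Rightarrow> 'a rel) \<Rightarrow> 'a set gorder" where
  "quotient_poset G r = \<lparr> carrier = cyclic_classes G, eq = (=),
     le = (\<lambda>S T. S = T \<or> (\<forall>x \<in> S. \<forall>y \<in> T. cyc_less G r x y)) \<rparr>"

definition poset_isomorphism :: "'a gorder \<Rightarrow> 'b gorder \<Rightarrow> ('a \<Rightarrow> 'b) \<Rightarrow> bool" where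
  "poset_isomorphism L M f \<longleftrightarrow> bij_betw f (carrier L) (carrier M) \<and>
     (\<forall>x \<in> carrier L. \<forall>y \<in> carrier L. x \<sqsubseteq>\<^bsub>L\<^esub> y \<longleftrightarrow> f x \<sqsubseteq>\<^bsub>M\<^esub> f y)"

context group
begin

lemma cyclic_class_iff:
  assumes "x \<in> carrier G"
  shows "y \<in> cyclic_class G x \<longleftrightarrow> y \<in> carrier G \<and> generate G {y} = generate G {x}"
  using assms generate_in_carrier[of "{x}" y] generate.incl[of y "{y}" G]
  by (auto simp: cyclic_class_def)

lemma cyc_less_iff:
  assumes "x \<in> carrier G" "y \<in> carrier G"
  shows "cyc_less G r x y \<longleftrightarrow>
    (generate G {x} = generate G {y} \<and> x \<noteq> y \<and> (x, y) \<in> r (cyclic_class G x)) \<or>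
    generate G {x} \<subset> generate G {y}"
proof -
  have eq: "cyclic_class G z = cyclic_class G x" if "z \<in> carrier G" "x \<in> cyclic_class G z" for z
    using that by (auto simp: cyclic_class_iff assms)
  have "(\<exists>S \<in> cyclic_classes G. x \<in> S \<and> y \<in> S \<and> x \<noteq> y \<and> (x, y) \<in> r S) \<longleftrightarrow>
    (generate G {x} = generate G {y} \<and> x \<noteq> y \<and> (x, y) \<in> r (cyclic_class G x))" (is "?L \<longleftrightarrow> ?R")
  proof
    assume ?L
    then obtain z where z: "z \<in> carrier G" "x \<in> cyclic_class G z" "y \<in> cyclic_class G z"
      "x \<noteq> y" "(x, y) \<in> r (cyclic_class G z)"
      unfolding cyclic_classes_def by blast
    have "generate G {x} = generate G {y}"
      using z(2,3) by (simp add: cyclic_class_def)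
    then show ?R using z(4,5) eq[OF z(1,2)] by simp
  next
    assume ?R then show ?L
      unfolding cyclic_classes_def using assms
      by (intro bexI[of _ "cyclic_class G x"]) (auto simp: cyclic_class_iff)
  qed
  then show ?thesis by (simp add: cyc_less_def)
qed

lemma partial_order_cyc_poset:
  assumes r: "class_ordering G r"
  shows "partial_order (cyc_poset G r)"
proof -
  have lin: "linear_order_on (cyclic_class G x) (r (cyclic_class G x))" if "x \<in> carrier G" for x
    using r that by (auto simp: class_ordering_def cyclic_classes_def)
  have cls: "cyclic_class G x = cyclic_class G y"
    if "generate G {x} = generate G {y}" for x y
    using that by (auto simp: cyclic_class_def)
  have asym: False if "x \<in> carrier G" "y \<in> carrier G" "cyc_less G r x y" "cyc_less G r y x" for x y
  proof -
    have eq: "generate G {x} = generate G {y}" and "x \<noteq> y"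
      using that(3,4) unfolding cyc_less_iff[OF that(1,2)] cyc_less_iff[OF that(2,1)] by blast+
    then have "(x, y) \<in> r (cyclic_class G x)" "(y, x) \<in> r (cyclic_class G x)"
      using that(3,4) unfolding cyc_less_iff[OF that(1,2)] cyc_less_iff[OF that(2,1)] cls[OF eq]
      by auto
    then show False
      using lin[OF that(1)] \<open>x \<noteq> y\<close>
      by (meson antisymD linear_order_on_def partial_order_on_def)
  qed
  have tr: "cyc_less G r x z"
    if H: "x \<in> carrier G" "y \<in> carrier G" "z \<in> carrier G" "cyc_less G r x y" "cyc_less G r y z" for x y z
  proof -
    have "x \<noteq> z" using asym H by blast
    have "trans (r (cyclic_class G x))"
      using lin[OF H(1)] by (simp add: order_on_defs)
    consider "generate G {x} = generate G {y}" "generate G {y} = generate G {z}"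
      | "generate G {x} \<subset> generate G {z}"
      using H(4,5) unfolding cyc_less_iff[OF H(1,2)] cyc_less_iff[OF H(2,3)] by blast
    then show ?thesis
    proof cases
      case 1
      then have "(x, y) \<in> r (cyclic_class G x)" "(y, z) \<in> r (cyclic_class G x)"
        using H(4,5) cls[OF 1(1)] unfolding cyc_less_iff[OF H(1,2)] cyc_less_iff[OF H(2,3)]
        by auto
      then have "(x, z) \<in> r (cyclic_class G x)"
        using \<open>trans (r (cyclic_class G x))\<close> by (meson transD)
      then show ?thesis using 1 \<open>x \<noteq> z\<close> by (simp add: cyc_less_iff[OF H(1,3)])
    qed (simp add: cyc_less_def)
  qed
  show ?thesis
  proof (standard, unfold cyc_poset_def gorder.simps eq_object.simps partial_object.simps)
    fix x y z assume "cyc_less G r x y \<or> x = y" "cyc_less G r y z \<or> y = z"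
      "x \<in> carrier G" "y \<in> carrier G" "z \<in> carrier G"
    then show "cyc_less G r x z \<or> x = z" using tr by blast
  qed (use asym in blast)+
qed

lemma partial_order_quotient_poset:
  assumes r: "class_ordering G r"
  shows "partial_order (quotient_poset G r)"
proof -
  interpret L: partial_order "cyc_poset G r" by (rule partial_order_cyc_poset[OF r])
  have sub: "S \<subseteq> carrier G" "S \<noteq> {}" if "S \<in> cyclic_classes G" for S
    using that by (auto simp: cyclic_classes_def cyclic_class_iff)
  have irr: "\<not> cyc_less G r x x" for x by (auto simp: cyc_less_def)
  have asym: False if "x \<in> carrier G" "y \<in> carrier G" "cyc_less G r x y" "cyc_less G r y x" for x y
    using that L.le_antisym[of x y] irr by (auto simp: cyc_poset_def)
  have tr: "cyc_less G r x z"
    if "x \<in> carrier G" "y \<in> carrier G" "z \<in> carrier G" "cyc_less G r x y" "cyc_less G r y z" for x y z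
    using that L.le_trans[of x y z] asym by (auto simp: cyc_poset_def)
  show ?thesis
  proof (standard; simp add: quotient_poset_def)
    fix S T assume "S = T \<or> (\<forall>x\<in>S. \<forall>y\<in>T. cyc_less G r x y)"
      "T = S \<or> (\<forall>x\<in>T. \<forall>y\<in>S. cyc_less G r x y)" "S \<in> cyclic_classes G" "T \<in> cyclic_classes G"
    then show "S = T" using sub asym by (metis all_not_in_conv subsetD)
  next
    fix S T U assume *: "S = T \<or> (\<forall>x\<in>S. \<forall>y\<in>T. cyc_less G r x y)"
      "T = U \<or> (\<forall>x\<in>T. \<forall>y\<in>U. cyc_less G r x y)"
      "S \<in> cyclic_classes G" "T \<in> cyclic_classes G" "U \<in> cyclic_classes G"
    then show "S = U \<or> (\<forall>x\<in>S. \<forall>y\<in>U. cyc_less G r x y)"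
    proof (cases "S = T \<or> T = U")
      case False
      obtain t where "t \<in> T" using sub(2) \<open>T \<in> cyclic_classes G\<close> by blast
      show ?thesis
      proof (intro disjI2 ballI)
        fix x y assume "x \<in> S" "y \<in> U"
        with False * \<open>t \<in> T\<close> have "cyc_less G r x t" "cyc_less G r t y" by auto
        moreover have "x \<in> carrier G" "t \<in> carrier G" "y \<in> carrier G"
          using sub(1) * \<open>x \<in> S\<close> \<open>t \<in> T\<close> \<open>y \<in> U\<close> by auto
        ultimately show "cyc_less G r x y" using tr by blast
      qed
    qed (use * in auto)
  qed
qed

lemma pair_graph_power_graph: "finite (carrier G) \<Longrightarrow> pair_graph (power_graph G)"
  by (standard; auto simp: power_graph_def symmetric_def intro: symI
      finite_subset[of _ "carrier G \<times> carrier G"])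

lemma pair_digraph_power_digraph: "finite (carrier G) \<Longrightarrow> pair_digraph (power_digraph G)"
  by (standard; auto simp: power_digraph_def intro: finite_subset[of _ "carrier G \<times> carrier G"])

lemma pair_digraph_order_digraph: "finite (carrier G) \<Longrightarrow> pair_digraph (order_digraph G r)"
  by (standard; auto simp: order_digraph_def cyc_less_def
      intro: finite_subset[of _ "carrier G \<times> carrier G"])

end

end

theory Submission
  imports Defs "HOL-Algebra.Multiplicative_Group" "HOL-Algebra.Sylow" "HOL-Number_Theory.Totient"
begin

text \<open>Only the step from the power graph to the power digraph is hard. Call two elements twins if they
  have the same closed neighbourhood in the power graph. Outside the set \<open>Z\<close> of vertices adjacent to
  everything, twins that generate different subgroups have prime power order, and between elements
  that are not twins the direction of an arc can be read off from the sizes of the twin classes.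
  If \<open>Z\<close> contains an element whose order is not a prime power, then this element generates the
  group. Otherwise \<open>Z\<close> lies below everything else, so for the largest element \<open>c\<close> of a twin class
  \<open>C\<close> the order of \<open>c\<close> is the size of \<open>C\<close> plus the number of elements below \<open>C\<close>. This order and the
  size of \<open>C\<close> determine the orders of all elements of \<open>C\<close>. Hence a graph isomorphism can be changed
  inside the twin classes so that it preserves orders, and then it is an isomorphism of
  digraphs.\<close>

text \<open>The isomorphism really has to be changed: the power graph of a cyclic group of prime
  power order is complete, so every permutation of it is an automorphism, whatever it does to
  orders. What the graph reveals is only how many elements of each order a twin class contains. This
  suffices because a twin class has a largest element and, inside one cyclic group, containment of
  cyclic subgroups is divisibility of orders. If \<open>Z\<close> contains an element whose order is
  not a prime power, both groups are cyclic of the same order and a fresh isomorphism is built from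
  the orders alone. The two groups cannot fall under different cases: in the other case a nontrivial
  \<open>Z\<close> forces the group order to be a prime power, and whether \<open>Z\<close> is
  trivial is visible in the graph. The remaining implications close a circle: containment passes to
  the quotient, equal class sizes allow classes to be matched rank by rank in the chosen orders, and
  comparability in the resulting poset is adjacency in the power graph.\<close>

section \<open>Bijections from matching fibres, and isomorphisms of pair digraphs\<close>

lemma bij_betw_of_equal_fibers:
  assumes "finite A" "finite B"
    and fib: "\<And>k. card {x \<in> A. \<kappa> x = k} = card {y \<in> B. \<mu> y = k}"
  shows "\<exists>g. bij_betw g A B \<and> (\<forall>x \<in> A. \<mu> (g x) = \<kappa> x)"
proof -
  have "\<exists>h. bij_betw h {x \<in> A. \<kappa> x = k} {y \<in> B. \<mu> y = k}" for k
    using assms by (intro finite_same_card_bij) auto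
  then obtain h where h: "\<And>k. bij_betw (h k) {x \<in> A. \<kappa> x = k} {y \<in> B. \<mu> y = k}"
    by metis
  define g where "g x = h (\<kappa> x) x" for x
  have gB: "g x \<in> B" "\<mu> (g x) = \<kappa> x" if "x \<in> A" for x
    using bij_betwE[OF h[of "\<kappa> x"]] that by (auto simp: g_def)
  have "inj_on g A"
  proof (rule inj_onI)
    fix x y assume "x \<in> A" "y \<in> A" "g x = g y"
    moreover from this have "\<kappa> x = \<kappa> y" using gB by metis
    ultimately show "x = y"
      using bij_betw_imp_inj_on[OF h[of "\<kappa> x"]] by (auto simp: g_def inj_on_def)
  qed
  moreover have "B \<subseteq> g ` A"
  proof
    fix y assume "y \<in> B"
    then have "y \<in> h (\<mu> y) ` {x \<in> A. \<kappa> x = \<mu> y}"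
      using bij_betw_imp_surj_on[OF h[of "\<mu> y"]] by auto
    then obtain x where "x \<in> A" "y = g x" by (auto simp: g_def)
    then show "y \<in> g ` A" by blast
  qed
  ultimately show ?thesis
    using gB by (intro exI[of _ g]) (auto simp: bij_betw_def)
qed

text \<open>A library isomorphism has separate maps for vertices, arcs, tails and heads. Between
  pair digraphs tail and head must be \<open>fst\<close> and \<open>snd\<close>, so the arc map is
  the vertex map applied to both ends; well-formedness places these ends where the vertex map is
  injective.\<close>

lemma digraph_iso_with_proj_iff:
  assumes "pair_wf_digraph P" "pair_wf_digraph Q"
  shows "digraph_iso (with_proj P) (with_proj Q) \<longleftrightarrow>
    (\<exists>f. bij_betw f (pverts P) (pverts Q) \<and>
      (\<forall>x \<in> pverts P. \<forall>y \<in> pverts P. (x, y) \<in> parcs P \<longleftrightarrow> (f x, f y) \<in> parcs Q))"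
    (is "?L \<longleftrightarrow> ?R")
proof
  assume ?L
  then obtain h where h: "pre_digraph.digraph_isomorphism (with_proj P) h"
    and Q: "with_proj Q = app_iso h (with_proj P)"
    unfolding digraph_iso_def by blast
  let ?f = "iso_verts h"
  have inj: "inj_on ?f (pverts P)"
    using h by (auto simp: pre_digraph.digraph_isomorphism_def)
  have V: "pverts Q = ?f ` pverts P" and A: "parcs Q = iso_arcs h ` parcs P"
    and t: "iso_tail h = fst" and hd: "iso_head h = snd"
    using arg_cong[OF Q, of verts] arg_cong[OF Q, of arcs] arg_cong[OF Q, of tail]
      arg_cong[OF Q, of head] by auto
  have arc: "iso_arcs h a = (?f (fst a), ?f (snd a))" if "a \<in> parcs P" for a
    using h that by (auto simp: pre_digraph.digraph_isomorphism_def t hd prod_eq_iff)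
  have PV: "fst a \<in> pverts P" "snd a \<in> pverts P" if "a \<in> parcs P" for a
    using pair_wf_digraph.arc_fst_in_verts[OF assms(1) that]
      pair_wf_digraph.arc_snd_in_verts[OF assms(1) that] by simp_all
  have "(x, y) \<in> parcs P \<longleftrightarrow> (?f x, ?f y) \<in> parcs Q" if "x \<in> pverts P" "y \<in> pverts P" for x y
  proof
    assume "(x, y) \<in> parcs P"
    then show "(?f x, ?f y) \<in> parcs Q" unfolding A by (auto simp: arc intro!: rev_image_eqI)
  next
    assume "(?f x, ?f y) \<in> parcs Q"
    then obtain a where a: "a \<in> parcs P" "?f x = ?f (fst a)" "?f y = ?f (snd a)"
      unfolding A by (auto simp: arc)
    then have "x = fst a" "y = snd a"
      using inj_onD[OF inj a(2) that(1) PV(1)[OF a(1)]] inj_onD[OF inj a(3) that(2) PV(2)[OF a(1)]]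
      by simp_all
    then show "(x, y) \<in> parcs P" using a(1) by simp
  qed
  then show ?R using inj V by (auto simp: bij_betw_def)
next
  assume ?R
  then obtain f where f: "bij_betw f (pverts P) (pverts Q)"
    and arcs: "\<And>x y. x \<in> pverts P \<Longrightarrow> y \<in> pverts P \<Longrightarrow> (x, y) \<in> parcs P \<longleftrightarrow> (f x, f y) \<in> parcs Q"
    by blast
  let ?h = "\<lparr>iso_verts = f, iso_arcs = map_prod f f, iso_head = snd, iso_tail = fst\<rparr>"
  have inj: "inj_on f (pverts P)" and V: "f ` pverts P = pverts Q"
    using f by (auto simp: bij_betw_def)
  have PV: "parcs P \<subseteq> pverts P \<times> pverts P" and QV: "parcs Q \<subseteq> pverts Q \<times> pverts Q"
    using assms by (force simp: pair_wf_digraph_def)+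
  have "inj_on (map_prod f f) (parcs P)"
    using map_prod_inj_on[OF inj inj] PV by (rule inj_on_subset)
  then have "pre_digraph.digraph_isomorphism (with_proj P) ?h"
    using inj assms(1) by (auto simp: pre_digraph.digraph_isomorphism_def wf_digraph_wp_iff)
  moreover have "map_prod f f ` parcs P = parcs Q"
  proof
    show "map_prod f f ` parcs P \<subseteq> parcs Q" using arcs PV by auto
    show "parcs Q \<subseteq> map_prod f f ` parcs P"
    proof
      fix b assume b: "b \<in> parcs Q"
      then have "b \<in> f ` pverts P \<times> f ` pverts P" using QV V by auto
      then obtain x y where "x \<in> pverts P" "y \<in> pverts P" "b = (f x, f y)" by auto
      then show "b \<in> map_prod f f ` parcs P"
        using b arcs by (auto intro!: rev_image_eqI)
    qed
  qed
  then have "with_proj Q = app_iso ?h (with_proj P)"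
    by (simp add: app_iso_def with_proj_def V)
  ultimately show ?L unfolding digraph_iso_def by blast
qed

section \<open>Numbers with linearly ordered divisors\<close>

text \<open>These are exactly the prime powers, 1 included. The divisor form is the one that
  adjacency produces: the subgroups of a cyclic group of such an order form a chain.\<close>

definition divisor_chain :: "nat \<Rightarrow> bool" where
  "divisor_chain n \<longleftrightarrow> (\<forall>a b. a dvd n \<longrightarrow> b dvd n \<longrightarrow> a dvd b \<or> b dvd a)"

lemma divisor_chain_dvd: "divisor_chain n \<Longrightarrow> m dvd n \<Longrightarrow> divisor_chain m"
  unfolding divisor_chain_def by (meson dvd_trans)

lemma divisor_chain_1 [simp]: "divisor_chain (Suc 0)"
  by (auto simp: divisor_chain_def)

lemma divisor_chain_prime_power:
  assumes "prime p"
  shows "divisor_chain (p ^ k)"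
proof -
  have "p ^ i dvd p ^ j \<or> p ^ j dvd p ^ i" for i j
    using le_imp_power_dvd[of i j p] le_imp_power_dvd[of j i p] by linarith
  then show ?thesis unfolding divisor_chain_def divides_primepow_nat[OF assms, of _ k] by blast
qed

lemma prime_power_if_unique_prime:
  fixes n p :: nat
  assumes "prime p" "n > 0" "\<And>q. prime q \<Longrightarrow> q dvd n \<Longrightarrow> q = p"
  shows "\<exists>k. n = p ^ k"
proof -
  obtain k m where km: "\<not> p dvd m" "n = m * p ^ k"
    using prime_power_canonical[OF assms(1,2)] by blast
  have "m = 1"
  proof (rule ccontr)
    assume "m \<noteq> 1"
    then obtain q where "prime q" "q dvd m" using prime_factor_nat by blast
    then show False using assms(3)[of q] km by auto
  qed
  then show ?thesis using km by auto
qed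

lemma divisor_chainE:
  assumes "divisor_chain n" "n > 1"
  obtains p k where "prime p" "n = p ^ k" "k > 0"
proof -
  obtain p where p: "prime p" "p dvd n" using assms(2) prime_factor_nat[of n] by auto
  have "q = p" if "prime q" "q dvd n" for q
    using assms(1) p that unfolding divisor_chain_def by (metis primes_dvd_imp_eq)
  moreover have "n > 0" using assms(2) by simp
  ultimately obtain k where "n = p ^ k" using prime_power_if_unique_prime[OF p(1)] by blast
  moreover from this have "k > 0" using assms(2) by (cases k) auto
  ultimately show ?thesis using that p(1) by blast
qed

definition dvd_comparable :: "nat \<Rightarrow> nat \<Rightarrow> bool" where
  "dvd_comparable a b \<longleftrightarrow> a dvd b \<or> b dvd a"

text \<open>For a prime \<open>q\<close> dividing \<open>n div d\<close>, the least power of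
  \<open>q\<close> that does not divide \<open>d\<close> still divides \<open>n\<close>. Being
  comparable with \<open>d\<close>, it is a multiple of \<open>d\<close>, so \<open>d\<close> is a
  power of \<open>q\<close>; a prime divisor of \<open>n\<close> that is comparable with
  \<open>d\<close> is then \<open>q\<close> itself.\<close>

lemma divisor_chain_if_comparable_divisor:
  assumes "d dvd n" "n > 0" "d \<noteq> 1" "d \<noteq> n"
    and cmp: "\<And>w. w dvd n \<Longrightarrow> dvd_comparable w d"
  shows "divisor_chain n"
proof -
  obtain e where e: "n = d * e" using assms(1) by blast
  then have "e \<noteq> 1" using assms by auto
  then obtain q where q: "prime q" "q dvd e" using prime_factor_nat by blast
  have d0: "d > 0" using assms e by auto
  obtain j m where jm: "\<not> q dvd m" "d = m * q ^ j"
    using prime_power_canonical[OF q(1) d0] by blast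
  have "q ^ Suc j dvd n"
    unfolding e jm(2) using q(2) by (metis dvd_triv_right mult_dvd_mono power_Suc2)
  moreover have "\<not> q ^ Suc j dvd d"
    using jm q(1) by (simp add: mult.commute[of m] prime_gt_0_nat)
  ultimately have "d dvd q ^ Suc j" using cmp by (auto simp: dvd_comparable_def)
  then obtain i where i: "d = q ^ i" using divides_primepow_nat[OF q(1)] by blast
  then have "i > 0" using assms(3) by (cases i) auto
  have "p = q" if "prime p" "p dvd n" for p
  proof -
    have "p dvd q ^ i \<or> q ^ i dvd p" using cmp[OF that(2)] by (simp add: dvd_comparable_def i)
    then have "p dvd q \<or> q dvd p"
      using that(1) \<open>i > 0\<close> by (meson dvd_power dvd_trans prime_dvd_power)
    then show ?thesis using that(1) q(1) by (metis primes_dvd_imp_eq)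
  qed
  then show ?thesis
    using prime_power_if_unique_prime[OF q(1) assms(2)] divisor_chain_prime_power[OF q(1)] by blast
qed

text \<open>In the application \<open>a\<close> and \<open>b\<close> are orders of twins below an
  element of order \<open>n\<close>. Divisors of \<open>b\<close> are comparable with
  \<open>b\<close>, hence with \<open>a\<close>, so the preceding lemma makes \<open>b\<close> a
  power of a prime \<open>p\<close>. Another prime \<open>q\<close> dividing \<open>n\<close> would
  give the divisor \<open>a * q\<close>, comparable with \<open>a\<close> but not with
  \<open>b\<close>.\<close>

lemma divisor_chain_if_twin_divisors:
  assumes "a dvd b" "b dvd n" "n > 0" "a \<noteq> 1" "a \<noteq> b"
    and twin: "\<And>w. w dvd n \<Longrightarrow> dvd_comparable w a \<longleftrightarrow> dvd_comparable w b"
  shows "divisor_chain n"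
proof -
  have b0: "b > 0" using assms by (auto intro!: Nat.gr0I)
  have "b > 1" using assms(1,4,5) b0 by (metis dvd_1_iff_1 One_nat_def Suc_lessI)
  have "divisor_chain b"
  proof (rule divisor_chain_if_comparable_divisor[OF assms(1) b0 assms(4,5)])
    fix w assume "w dvd b"
    moreover from this have "w dvd n" using assms(2) dvd_trans by blast
    ultimately show "dvd_comparable w a" using twin by (auto simp: dvd_comparable_def)
  qed
  then obtain p k where p: "prime p" and b: "b = p ^ k" "k > 0"
    using divisor_chainE \<open>b > 1\<close> by blast
  have "q = p" if q: "prime q" "q dvd n" for q
  proof (rule ccontr)
    assume "q \<noteq> p"
    then have cop: "coprime q b" unfolding b using p q(1) by (simp add: primes_coprime)
    then have "coprime q a" using assms(1) by (meson coprime_divisors dvd_refl)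
    then have "a * q dvd n"
      using assms(1,2) q(2) by (meson coprime_commute divides_mult dvd_trans)
    moreover have "dvd_comparable (a * q) a" by (simp add: dvd_comparable_def)
    ultimately have "dvd_comparable (a * q) b" using twin by blast
    then consider "q dvd b" | "b dvd a * q" by (auto simp: dvd_comparable_def dest: dvd_mult_right)
    then show False
    proof cases
      case 1 then show False using cop q(1) by (meson coprime_absorb_left not_prime_unit)
    next
      case 2 then have "b dvd a" using cop by (simp add: coprime_commute coprime_dvd_mult_left_iff)
      then show False using assms(1,5) by (simp add: dvd_antisym)
    qed
  qed
  then show ?thesis
    using prime_power_if_unique_prime[OF p assms(3)] divisor_chain_prime_power[OF p] by blast
qed

text \<open>For \<open>n = p ^ k\<close> the largest proper divisor is \<open>p ^ (k - 1)\<close>,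
  and the totient is \<open>p - 1\<close> times as large. This is why twin classes grow in size from
  bottom to top at prime power orders.\<close>

lemma proper_divisor_le_totient:
  assumes "divisor_chain n" "n > 0" "d dvd n" "d \<noteq> n"
  shows "d \<le> totient n"
proof -
  have "n > 1" using assms by (metis One_nat_def Suc_lessI dvd_1_iff_1)
  then obtain p k where p: "prime p" and n: "n = p ^ k" "k > 0" using assms(1) divisor_chainE by blast
  obtain i where i: "i \<le> k" "d = p ^ i" using assms(3) divides_primepow_nat[OF p] n by auto
  then have "i \<le> k - 1" using assms(4) n by (cases "i = k") auto
  then have "d \<le> p ^ (k - 1)" using i p by (metis power_increasing prime_ge_1_nat)
  also have "\<dots> \<le> p ^ (k - 1) * (p - 1)" using prime_gt_1_nat[OF p] by simp
  also have "\<dots> = totient n" using totient_prime_power[OF p n(2)] n by simp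
  finally show ?thesis .
qed

lemma totient_eq_1_imp: "totient n = 1 \<Longrightarrow> n = 1 \<or> n = 2"
  using totient_gt_1[of n] by (cases "n > 2") (auto simp: not_less le_Suc_eq numeral_2_eq_2)

text \<open>Source of the only tie between class sizes. With \<open>n = d * e\<close> and
  \<open>g = gcd d e\<close> the product formula reduces to
  \<open>totient g = totient e * g\<close>; since \<open>totient g \<le> g\<close>, this forces
  \<open>totient e = 1\<close>, so \<open>e = 2\<close>. For even \<open>d\<close>, doubling would
  double the totient.\<close>

lemma totient_eq_proper_divisor:
  assumes "d dvd n" "n > 0" "d \<noteq> n" "totient d = totient n"
  shows "odd d" "n = 2 * d"
proof -
  obtain e where e: "n = d * e" using assms(1) by blast
  have pos: "d > 0" "e > 0" using e assms(2) by auto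
  let ?g = "gcd d e"
  have g: "?g > 0" using pos by simp
  have "totient n * totient ?g = totient d * totient e * ?g" unfolding e by (rule totient_gcd)
  then have "totient d * totient ?g = totient d * (totient e * ?g)" using assms(4) by (simp add: mult.assoc)
  then have *: "totient ?g = totient e * ?g" using pos by simp
  have "totient e * ?g \<le> 1 * ?g" using totient_le[of ?g] * by simp
  then have "totient e \<le> 1" using g mult_le_cancel2 by blast
  moreover have "totient e > 0" using pos by simp
  ultimately have "totient e = 1" by linarith
  then have "e = 1 \<or> e = 2" by (rule totient_eq_1_imp)
  then have "e = 2" using e assms(3) by auto
  then show "n = 2 * d" using e by simp
  then show "odd d" using totient_double[of d] assms(4) pos by (auto split: if_splits)
qed

section \<open>Cyclic subgroups of finite groups\<close>

text \<open>Unlike the arcs, \<open>pow_le\<close> and \<open>pow_adj\<close> include the diagonal: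
  the first is then a preorder whose equivalence classes are the cyclic classes, and
  \<open>pow_adj\<close> describes the closed neighbourhoods that define twins.\<close>

definition pow_le :: "('a, 'm) monoid_scheme \<Rightarrow> 'a \<Rightarrow> 'a \<Rightarrow> bool" where
  "pow_le G x y \<longleftrightarrow> generate G {x} \<subseteq> generate G {y}"

definition pow_adj :: "('a, 'm) monoid_scheme \<Rightarrow> 'a \<Rightarrow> 'a \<Rightarrow> bool" where
  "pow_adj G x y \<longleftrightarrow> pow_le G x y \<or> pow_le G y x"

lemma pow_le_refl [simp]: "pow_le G x x"
  by (simp add: pow_le_def)

lemma pow_le_trans: "pow_le G x y \<Longrightarrow> pow_le G y z \<Longrightarrow> pow_le G x z"
  by (auto simp: pow_le_def)

lemma pow_adj_refl [simp]: "pow_adj G x x"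
  by (simp add: pow_adj_def)

lemma pow_adj_sym: "pow_adj G x y \<Longrightarrow> pow_adj G y x"
  by (auto simp: pow_adj_def)

locale fin_group = group +
  assumes fin [simp]: "finite (carrier G)"
begin

lemma pow_le_iff_generate:
  assumes "x \<in> carrier G" "y \<in> carrier G"
  shows "pow_le G x y \<longleftrightarrow> x \<in> generate G {y}"
proof
  show "pow_le G x y \<Longrightarrow> x \<in> generate G {y}"
    using generate.incl[of x "{x}" G] by (auto simp: pow_le_def)
  show "x \<in> generate G {y} \<Longrightarrow> pow_le G x y"
    unfolding pow_le_def using assms by (intro generate_subgroup_incl generate_is_subgroup) auto
qed

lemma generate_eq_pow_le: "y \<in> carrier G \<Longrightarrow> generate G {y} = {x \<in> carrier G. pow_le G x y}"
  using pow_le_iff_generate[of _ y] generate_in_carrier[of "{y}"] by blast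

lemma ord_eq_card_pow_le: "y \<in> carrier G \<Longrightarrow> ord y = card {x \<in> carrier G. pow_le G x y}"
  by (simp add: generate_pow_card generate_eq_pow_le)

lemma ord_pos [simp]: "x \<in> carrier G \<Longrightarrow> ord x > 0"
  using ord_ge_1[OF fin] by (metis gr0I not_one_le_zero)

lemma pow_mod_ord:
  assumes "x \<in> carrier G"
  shows "x [^] (k mod ord x) = x [^] (k::nat)"
proof -
  have "x [^] k = x [^] (ord x * (k div ord x) + k mod ord x)" by simp
  also have "\<dots> = x [^] (ord x * (k div ord x)) \<otimes> x [^] (k mod ord x)"
    using assms by (simp only: nat_pow_mult)
  also have "x [^] (ord x * (k div ord x)) = \<one>"
    using assms pow_eq_id[of x "ord x * (k div ord x)"] by simp
  finally show ?thesis using assms by simp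
qed

lemma pow_le_iff_pow:
  assumes "x \<in> carrier G" "y \<in> carrier G"
  shows "pow_le G x y \<longleftrightarrow> (\<exists>k::nat. x = y [^] k)"
  unfolding pow_le_iff_generate[OF assms] generate_pow_on_finite_carrier[OF fin assms(2)] by auto

lemma is_power_of_iff_pow_le:
  assumes "x \<in> carrier G" "y \<in> carrier G"
  shows "is_power_of G x y \<longleftrightarrow> pow_le G x y"
proof
  show "is_power_of G x y \<Longrightarrow> pow_le G x y"
    unfolding is_power_of_def pow_le_iff_pow[OF assms] by auto
  assume "pow_le G x y"
  then obtain k :: nat where k: "x = y [^] k" unfolding pow_le_iff_pow[OF assms] by blast
  \<comment> \<open>Adding \<open>ord y\<close> makes the exponent positive without changing the
    power.\<close>
  have "x = y [^] (k + ord y)" using assms k by (simp add: nat_pow_mult[symmetric])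
  then show "is_power_of G x y"
    unfolding is_power_of_def using ord_pos[OF assms(2)] by (intro exI[of _ "k + ord y"]) auto
qed

lemma ord_dvd_if_pow_le:
  assumes "x \<in> carrier G" "y \<in> carrier G" "pow_le G x y"
  shows "ord x dvd ord y"
proof -
  obtain k :: nat where k: "x = y [^] k" using assms pow_le_iff_pow by blast
  have "x [^] ord y = (y [^] ord y) [^] k"
    using assms unfolding k by (simp only: nat_pow_pow mult.commute)
  then have "x [^] ord y = \<one>" using assms(2) by simp
  then show ?thesis using assms(1) by (simp add: pow_eq_id)
qed

text \<open>Counting: with \<open>k = ord y\<close>, the equation \<open>w [^] k = \<one>\<close>
  has at most \<open>k\<close> solutions below \<open>c\<close>, namely the powers of
  \<open>c [^] e\<close> where \<open>ord c = k * e\<close>. The \<open>k\<close> elements below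
  \<open>y\<close> are solutions, so they are all of them, and \<open>x\<close> is a solution
  too.\<close>

lemma ord_dvd_imp_pow_le:
  assumes "c \<in> carrier G" "x \<in> carrier G" "y \<in> carrier G"
    and "pow_le G x c" "pow_le G y c" "ord x dvd ord y"
  shows "pow_le G x y"
proof -
  let ?S = "{w \<in> carrier G. pow_le G w c \<and> w [^] ord y = \<one>}"
  let ?n = "ord c" and ?k = "ord y"
  obtain e where e: "?n = ?k * e" using ord_dvd_if_pow_le assms by blast
  have e0: "e > 0" and k0: "?k > 0" using e ord_pos[OF assms(1)] by (auto intro!: Nat.gr0I)
  have "?S \<subseteq> (\<lambda>i. c [^] (i * e)) ` {..<?k}"
  proof
    fix w assume w: "w \<in> ?S"
    then obtain j :: nat where j: "w = c [^] j" using assms(1) pow_le_iff_pow by blast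
    have "c [^] (j * ?k) = \<one>" using w assms(1) by (simp add: j nat_pow_pow)
    then have "?k * e dvd j * ?k" using assms(1) pow_eq_id[of c] e by simp
    then have "e dvd j" using k0 by (simp add: mult.commute)
    then obtain i where i: "j = i * e" by (metis dvdE mult.commute)
    have "(i mod ?k) * e = (i * e) mod ?n"
      unfolding e by (simp add: mult_mod_left)
    then have "w = c [^] ((i mod ?k) * e)"
      using pow_mod_ord[OF assms(1)] by (simp add: j i)
    then show "w \<in> (\<lambda>i. c [^] (i * e)) ` {..<?k}" using k0 by auto
  qed
  then have fS: "finite ?S" and "card ?S \<le> ?k"
    using surj_card_le[of "{..<?k}" ?S] by auto
  moreover have sub: "{w \<in> carrier G. pow_le G w y} \<subseteq> ?S"
    using pow_le_trans[OF _ assms(5)] ord_dvd_if_pow_le[OF _ assms(3)] by (auto simp: pow_eq_id)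
  ultimately have "{w \<in> carrier G. pow_le G w y} = ?S"
    using ord_eq_card_pow_le[OF assms(3)] card_mono[OF fS sub] by (intro card_subset_eq) auto
  moreover have "x \<in> ?S" using assms by (simp add: pow_eq_id)
  ultimately show ?thesis by blast
qed

lemma pow_le_iff_ord_dvd:
  assumes "c \<in> carrier G" "x \<in> carrier G" "y \<in> carrier G" "pow_le G x c" "pow_le G y c"
  shows "pow_le G x y \<longleftrightarrow> ord x dvd ord y"
  using ord_dvd_imp_pow_le[OF assms] ord_dvd_if_pow_le[OF assms(2,3)] by blast

lemma pow_adj_iff_dvd_comparable:
  assumes "c \<in> carrier G" "x \<in> carrier G" "y \<in> carrier G" "pow_le G x c" "pow_le G y c"
  shows "pow_adj G x y \<longleftrightarrow> dvd_comparable (ord x) (ord y)"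
  using pow_le_iff_ord_dvd[OF assms] pow_le_iff_ord_dvd[OF assms(1,3,2,5,4)]
  by (simp add: pow_adj_def dvd_comparable_def)

lemma pow_le_if_ord_eq:
  assumes "x \<in> carrier G" "y \<in> carrier G" "pow_le G x y" "ord x = ord y"
  shows "pow_le G y x"
  using assms pow_le_iff_ord_dvd[of y y x] by simp

lemma ex_pow_le_ord:
  assumes "c \<in> carrier G" "k dvd ord c"
  obtains x where "x \<in> carrier G" "pow_le G x c" "ord x = k"
proof -
  obtain e where e: "ord c = k * e" using assms(2) by blast
  then have e0: "e \<noteq> 0" using ord_pos[OF assms(1)] by (metis less_irrefl mult_0_right)
  then have "ord (c [^] e) = k" using ord_pow[OF assms(1), of e] e by simp
  moreover have "pow_le G (c [^] e) c" using assms(1) pow_le_iff_pow[of "c [^] e" c] by auto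
  ultimately show ?thesis using that assms(1) by blast
qed

lemma one_pow_le [simp]: "x \<in> carrier G \<Longrightarrow> pow_le G \<one> x"
  using pow_le_iff_pow[of \<one> x] nat_pow_0[of x] by (metis one_closed)

lemma ord_eq_1_iff: "x \<in> carrier G \<Longrightarrow> ord x = Suc 0 \<longleftrightarrow> x = \<one>"
  using ord_eq_1[of x] by simp

lemma cyclic_class_conv:
  assumes "x \<in> carrier G"
  shows "cyclic_class G x = {y \<in> carrier G. pow_le G y x \<and> pow_le G x y}"
  using cyclic_class_iff[OF assms] by (auto simp: pow_le_def)

lemma cyclic_class_eq_ord:
  assumes "c \<in> carrier G" "x \<in> carrier G" "pow_le G x c"
  shows "{y \<in> carrier G. pow_le G y c \<and> ord y = ord x} = cyclic_class G x"
proof -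
  have "pow_le G y c \<and> ord y = ord x \<longleftrightarrow> pow_le G y x \<and> pow_le G x y" if "y \<in> carrier G" for y
    using pow_le_iff_ord_dvd[OF assms(1,2) that assms(3)] pow_le_iff_ord_dvd[OF assms(1) that assms(2) _ assms(3)]
      pow_le_trans[OF _ assms(3), of y]
    by (auto intro: dvd_antisym)
  then show ?thesis using cyclic_class_conv[OF assms(2)] by auto
qed

lemma card_cyclic_class:
  assumes x: "x \<in> carrier G"
  shows "card (cyclic_class G x) = totient (ord x)"
proof -
  let ?n = "ord x"
  have "cyclic_class G x = (\<lambda>k. x [^] k) ` totatives ?n"
  proof (intro equalityI subsetI)
    fix y assume "y \<in> cyclic_class G x"
    then have y: "y \<in> carrier G" "pow_le G y x" "ord y = ?n"
      using cyclic_class_eq_ord[OF x x] by auto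
    then have "y \<in> (\<lambda>k. x [^] k) ` {1..?n}"
    proof -
      obtain k :: nat where k: "y = x [^] k" using y x pow_le_iff_pow by blast
      \<comment> \<open>Totatives of \<open>?n\<close> lie between 1 and \<open>?n\<close>, so the
        residue 0 is represented by \<open>?n\<close>; this matters for \<open>x = \<one>\<close>,
        where \<open>?n = 1\<close>.\<close>
      define j where "j = (if k mod ?n = 0 then ?n else k mod ?n)"
      have "y = x [^] j"
        using x pow_mod_ord[OF x, of k] by (auto simp: k j_def)
      moreover have "j \<in> {1..?n}" using ord_pos[OF x] by (auto simp: j_def Suc_le_eq order.strict_implies_order)
      ultimately show ?thesis by blast
    qed
    then obtain j where j: "j \<in> {1..?n}" "y = x [^] j" by blast
    have "?n div gcd ?n j = ?n" using y(3) ord_pow_gen[OF x, of j] j by auto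
    then have "gcd ?n j = 1" using ord_pos[OF x] by (simp add: div_eq_dividend_iff)
    then show "y \<in> (\<lambda>k. x [^] k) ` totatives ?n"
      using j by (auto simp: totatives_def coprime_iff_gcd_eq_1 gcd.commute)
  next
    fix y assume "y \<in> (\<lambda>k. x [^] k) ` totatives ?n"
    then obtain j where j: "j \<in> totatives ?n" "y = x [^] j" by blast
    have "ord y = ?n"
      using ord_pow_gen[OF x, of j] j by (auto simp: totatives_def coprime_iff_gcd_eq_1 gcd.commute)
    moreover have "pow_le G y x" "y \<in> carrier G" using j x pow_le_iff_pow by auto
    ultimately show "y \<in> cyclic_class G x" using cyclic_class_eq_ord[OF x x] by auto
  qed
  moreover have "inj_on (\<lambda>k. x [^] k) (totatives ?n)"
    by (rule inj_on_subset[OF ord_inj'[OF x]]) (auto simp: totatives_def)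
  ultimately show ?thesis by (simp add: card_image totient_def)
qed

end

section \<open>Twins\<close>

definition twins :: "'a set \<Rightarrow> ('a \<Rightarrow> 'a \<Rightarrow> bool) \<Rightarrow> 'a \<Rightarrow> 'a set" where
  "twins V E x = {y \<in> V. \<forall>z \<in> V. E y z \<longleftrightarrow> E x z}"

definition dominating :: "'a set \<Rightarrow> ('a \<Rightarrow> 'a \<Rightarrow> bool) \<Rightarrow> 'a set" where
  "dominating V E = {x \<in> V. \<forall>y \<in> V. E x y}"

text \<open>A description of the relation \<open>\<langle>x\<rangle> \<subset> \<langle>y\<rangle>\<close> between elements \<open>x\<close>, \<open>y\<close> that are not twins
  in terms of the undirected power graph alone. The last disjunct settles the case that \<open>x\<close> has odd
  order \<open>m\<close> and \<open>y\<close> has order \<open>2m\<close>, where the class sizes coincide: \<open>t\<close> is then the involution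
  of \<open>\<langle>y\<rangle>\<close>.\<close>

definition twin_below :: "'a set \<Rightarrow> ('a \<Rightarrow> 'a \<Rightarrow> bool) \<Rightarrow> 'a \<Rightarrow> 'a \<Rightarrow> bool" where
  "twin_below V E x y \<longleftrightarrow> y \<notin> dominating V E \<and> (x \<in> dominating V E \<or>
     E x y \<and> y \<notin> twins V E x \<and>
     (card (twins V E x) < card (twins V E y) \<or>
      card (twins V E x) = card (twins V E y) \<and>
        (\<exists>t \<in> V. card (twins V E t) = 1 \<and> E t y \<and> \<not> E t x)))"

lemma twins_refl: "x \<in> V \<Longrightarrow> x \<in> twins V E x"
  by (simp add: twins_def)

lemma twins_eq: "y \<in> twins V E x \<Longrightarrow> twins V E y = twins V E x"
  by (auto simp: twins_def)

lemma twins_eq_iff: "x \<in> V \<Longrightarrow> twins V E y = twins V E x \<longleftrightarrow> x \<in> twins V E y"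
  using twins_refl[of x V E] twins_eq[of x V E y] by auto

lemma twins_sym: "x \<in> V \<Longrightarrow> y \<in> twins V E x \<Longrightarrow> x \<in> twins V E y"
  by (auto simp: twins_def)

lemma dominating_twins: "y \<in> twins V E x \<Longrightarrow> x \<in> V \<Longrightarrow> y \<in> dominating V E \<longleftrightarrow> x \<in> dominating V E"
  by (auto simp: twins_def dominating_def)

text \<open>\<open>twin_below\<close> is really a relation between twin classes. Any bijection that
  agrees with a graph isomorphism up to twins therefore preserves it.\<close>

lemma twin_below_twins:
  assumes sym: "\<And>a b. E a b \<Longrightarrow> E b a"
    and "x \<in> V" "y \<in> V" "x' \<in> twins V E x" "y' \<in> twins V E y"
  shows "twin_below V E x' y' \<longleftrightarrow> twin_below V E x y"
proof -
  have V: "x' \<in> V" "y' \<in> V" using assms(4,5) by (auto simp: twins_def)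
  have x: "E x' z \<longleftrightarrow> E x z" "E z x' \<longleftrightarrow> E z x" if "z \<in> V" for z
    using assms(4) that sym by (auto simp: twins_def)
  have y: "E y' z \<longleftrightarrow> E y z" "E z y' \<longleftrightarrow> E z y" if "z \<in> V" for z
    using assms(5) that sym by (auto simp: twins_def)
  have "y' \<in> twins V E x \<longleftrightarrow> y \<in> twins V E x"
    using assms(3) V y by (auto simp: twins_def)
  then show ?thesis
    unfolding twin_below_def twins_eq[OF assms(4)] twins_eq[OF assms(5)]
      dominating_twins[OF assms(4,2)] dominating_twins[OF assms(5,3)]
    using x y V assms(2,3) by auto
qed

locale graph_isomorphism =
  fixes V :: "'a set" and E :: "'a \<Rightarrow> 'a \<Rightarrow> bool" and W :: "'b set" and F :: "'b \<Rightarrow> 'b \<Rightarrow> bool"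
    and f :: "'a \<Rightarrow> 'b"
  assumes bij: "bij_betw f V W"
    and iso: "\<And>x y. x \<in> V \<Longrightarrow> y \<in> V \<Longrightarrow> E x y \<longleftrightarrow> F (f x) (f y)"
begin

lemma f_in [simp]: "x \<in> V \<Longrightarrow> f x \<in> W"
  using bij by (auto simp: bij_betw_def)

lemma W_eq: "W = f ` V"
  using bij by (auto simp: bij_betw_def)

lemma ball_W: "(\<forall>z \<in> W. P z) \<longleftrightarrow> (\<forall>z \<in> V. P (f z))"
  by (simp add: W_eq)

lemma bex_W: "(\<exists>z \<in> W. P z) \<longleftrightarrow> (\<exists>z \<in> V. P (f z))"
  by (simp add: W_eq)

lemma twins_image:
  assumes "x \<in> V"
  shows "twins W F (f x) = f ` twins V E x"
proof -
  have "{w \<in> W. P w} = f ` {v \<in> V. P (f v)}" for P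
    by (auto simp: W_eq)
  then show ?thesis
    using assms by (auto simp: twins_def ball_W iso)
qed

lemma twins_image_iff: "x \<in> V \<Longrightarrow> y \<in> V \<Longrightarrow> f y \<in> twins W F (f x) \<longleftrightarrow> y \<in> twins V E x"
  by (simp add: twins_def ball_W iso)

lemma card_twins: "x \<in> V \<Longrightarrow> card (twins W F (f x)) = card (twins V E x)"
  unfolding twins_image using bij
  by (intro card_image) (auto simp: bij_betw_def twins_def inj_on_def)

lemma dominating_iff: "x \<in> V \<Longrightarrow> f x \<in> dominating W F \<longleftrightarrow> x \<in> dominating V E"
  by (simp add: dominating_def ball_W iso)

lemma twin_below_iff:
  assumes "x \<in> V" "y \<in> V"
  shows "twin_below W F (f x) (f y) \<longleftrightarrow> twin_below V E x y"
  using assms by (simp add: twin_below_def twins_image_iff card_twins dominating_iff bex_W iso cong: bex_cong)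

end

section \<open>Twins in the power graph of a finite group\<close>

context fin_group
begin

abbreviation "tw \<equiv> twins (carrier G) (pow_adj G)"
abbreviation "dm \<equiv> dominating (carrier G) (pow_adj G)"

lemma twin_carrier: "y \<in> tw x \<Longrightarrow> y \<in> carrier G"
  by (simp add: twins_def)

lemma twin_adj: "y \<in> tw x \<Longrightarrow> z \<in> carrier G \<Longrightarrow> pow_adj G z y \<longleftrightarrow> pow_adj G z x"
  using pow_adj_sym[of G] by (auto simp: twins_def)

lemma twins_adj:
  assumes "x \<in> carrier G" "a \<in> tw x" "b \<in> tw x"
  shows "pow_adj G a b"
  using twin_adj[OF assms(3) twin_carrier[OF assms(2)]] twin_adj[OF assms(2,1)]
    pow_adj_sym[of G x a] by simp

lemma finite_twins [simp]: "finite (tw x)"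
  by (rule finite_subset[OF _ fin]) (auto simp: twins_def)

lemma one_dominating: "\<one> \<in> dm"
  by (simp add: dominating_def pow_adj_def)

lemma cyclic_class_subset_twins:
  assumes "x \<in> carrier G"
  shows "cyclic_class G x \<subseteq> tw x"
  unfolding cyclic_class_conv[OF assms]
  by (auto simp: twins_def pow_adj_def intro: pow_le_trans)

text \<open>The closed neighbourhood of \<one> is the whole group, so the dominating vertices form a
  single twin class.\<close>

lemma dominating_iff_twin_one: "x \<in> dm \<longleftrightarrow> x \<in> tw \<one>"
  using one_dominating by (auto simp: dominating_def twins_def)

text \<open>Below \<open>y\<close> adjacency is comparability of orders, and every divisor of
  \<open>ord y\<close> is the order of an element below \<open>y\<close>. The twins \<open>a\<close>
  and \<open>b\<close> thus become the two twin divisors of the arithmetic lemma.\<close>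

lemma divisor_chain_if_twins_le:
  assumes "a \<in> carrier G" "b \<in> tw a" "y \<in> carrier G" "pow_le G a b" "\<not> pow_le G b a"
    and "pow_le G b y" "a \<noteq> \<one>"
  shows "divisor_chain (ord y)"
proof (rule divisor_chain_if_twin_divisors)
  have b: "b \<in> carrier G" using assms(2) by (rule twin_carrier)
  show "ord a dvd ord b" "ord b dvd ord y"
    using assms b ord_dvd_if_pow_le by auto
  show "ord y > 0" "ord a \<noteq> 1" using assms ord_eq_1_iff by auto
  show "ord a \<noteq> ord b" using assms b pow_le_if_ord_eq by blast
  fix w assume "w dvd ord y"
  then obtain u where u: "u \<in> carrier G" "pow_le G u y" "ord u = w"
    using ex_pow_le_ord assms(3) by blast
  have "pow_le G a y" using pow_le_trans[OF assms(4,6)] .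
  then show "dvd_comparable w (ord a) \<longleftrightarrow> dvd_comparable w (ord b)"
    using u(3) twin_adj[OF assms(2) u(1)] pow_adj_iff_dvd_comparable[OF assms(3) u(1) assms(1) u(2)]
      pow_adj_iff_dvd_comparable[OF assms(3) u(1) b u(2) assms(6)] by simp
qed

lemma divisor_chain_if_pow_adj:
  assumes "x \<in> carrier G" "y \<in> carrier G" "pow_le G x y" "\<not> pow_le G y x" "x \<noteq> \<one>"
    and "\<And>w. w \<in> carrier G \<Longrightarrow> pow_le G w y \<Longrightarrow> pow_adj G w x"
  shows "divisor_chain (ord y)"
proof (rule divisor_chain_if_comparable_divisor)
  show "ord x dvd ord y" "ord y > 0" "ord x \<noteq> 1" using assms ord_eq_1_iff ord_dvd_if_pow_le by auto
  show "ord x \<noteq> ord y" using assms pow_le_if_ord_eq by blast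
  fix w assume "w dvd ord y"
  then obtain u where u: "u \<in> carrier G" "pow_le G u y" "ord u = w"
    using ex_pow_le_ord assms(2) by blast
  then show "dvd_comparable w (ord x)"
    using pow_adj_iff_dvd_comparable[OF assms(2) u(1) assms(1) u(2) assms(3)] assms(6) by auto
qed

lemma pow_adj_if_divisor_chain:
  assumes "divisor_chain (ord y)" "x \<in> carrier G" "z \<in> carrier G" "y \<in> carrier G"
    and "pow_le G x y" "pow_le G z y"
  shows "pow_adj G x z"
  using pow_adj_iff_dvd_comparable[OF assms(4,2,3,5,6)] assms ord_dvd_if_pow_le
  unfolding divisor_chain_def dvd_comparable_def by blast

text \<open>Twins are pairwise adjacent, because each belongs to its own closed neighbourhood. An
  element of maximal order in the class is therefore above all others: anything strictly above it
  would have larger order.\<close>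

lemma twins_top:
  assumes "x \<in> carrier G"
  obtains c where "c \<in> tw x" "\<And>y. y \<in> tw x \<Longrightarrow> pow_le G y c"
proof -
  have "tw x \<noteq> {}" using twins_refl[OF assms] by blast
  then have "Max (ord ` tw x) \<in> ord ` tw x" by (intro Max_in) auto
  then obtain c where "c \<in> tw x" "ord c = Max (ord ` tw x)" by (metis imageE)
  then have c: "c \<in> tw x" "\<And>y. y \<in> tw x \<Longrightarrow> ord y \<le> ord c" by auto
  have "pow_le G y c" if y: "y \<in> tw x" for y
  proof (rule ccontr)
    assume n: "\<not> pow_le G y c"
    have C: "y \<in> carrier G" "c \<in> carrier G" using y c twin_carrier by auto
    have "pow_le G c y" using twins_adj[OF assms y c(1)] n by (auto simp: pow_adj_def)
    then have "ord c dvd ord y" "ord c \<noteq> ord y"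
      using n ord_dvd_if_pow_le[OF C(2,1)] pow_le_if_ord_eq[OF C(2,1)] by auto
    then show False using c(2)[OF y] ord_pos[OF C(1)] dvd_imp_le[of "ord c" "ord y"] by simp
  qed
  then show ?thesis using that c(1) by blast
qed

text \<open>Suppose the order of a dominating \<open>z\<close> is not a prime power. An
  \<open>x\<close> not below \<open>z\<close> would lie strictly above it, where comparability with
  \<open>z\<close> forces \<open>ord x\<close>, and so its divisor \<open>ord z\<close>, to be a
  prime power; hence \<open>z\<close> generates the group, which the assumption excludes. Once
  \<open>ord z\<close> is a prime power, every \<open>x\<close> below \<open>z\<close> is
  dominating: an element above \<open>z\<close> is above \<open>x\<close>, and the elements below
  \<open>z\<close> are pairwise adjacent.\<close>

lemma dominating_dichotomy:
  assumes "\<And>z. z \<in> carrier G \<Longrightarrow> (\<And>x. x \<in> carrier G \<Longrightarrow> pow_le G x z) \<Longrightarrow> divisor_chain (ord z)"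
  shows "\<forall>z \<in> dm. divisor_chain (ord z) \<and> (\<forall>x \<in> carrier G - dm. pow_le G z x)"
proof
  fix z assume z: "z \<in> dm"
  then have zC: "z \<in> carrier G" and adj: "\<And>x. x \<in> carrier G \<Longrightarrow> pow_adj G z x"
    by (auto simp: dominating_def)
  have ch: "divisor_chain (ord z)"
  proof (rule ccontr)
    assume n: "\<not> divisor_chain (ord z)"
    then have z1: "z \<noteq> \<one>" by auto
    have "pow_le G x z" if x: "x \<in> carrier G" for x
    proof (rule ccontr)
      assume nx: "\<not> pow_le G x z"
      then have le: "pow_le G z x" using adj[OF x] by (auto simp: pow_adj_def)
      have "divisor_chain (ord x)"
        by (rule divisor_chain_if_pow_adj[OF zC x le nx z1]) (rule pow_adj_sym, rule adj)
      then show False using n divisor_chain_dvd[OF _ ord_dvd_if_pow_le[OF zC x le]] by blast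
    qed
    then show False using assms zC n by blast
  qed
  moreover have "pow_le G z x" if x: "x \<in> carrier G - dm" for x
  proof (rule ccontr)
    assume "\<not> pow_le G z x"
    then have le: "pow_le G x z" using adj x by (auto simp: pow_adj_def)
    have "pow_adj G x w" if w: "w \<in> carrier G" for w
    proof (cases "pow_le G z w")
      case True
      then show ?thesis using pow_le_trans[OF le] by (simp add: pow_adj_def)
    next
      case False
      then have "pow_le G w z" using adj[OF w] by (auto simp: pow_adj_def)
      then show ?thesis using pow_adj_if_divisor_chain[OF ch _ w zC le] x by auto
    qed
    then show False using x by (auto simp: dominating_def)
  qed
  ultimately show "divisor_chain (ord z) \<and> (\<forall>x \<in> carrier G - dm. pow_le G z x)" by blast
qed

end

section \<open>Groups whose dominating vertices lie below everything else\<close>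

locale fin_group_central = fin_group +
  assumes dm_chain: "\<And>z. z \<in> dm \<Longrightarrow> divisor_chain (ord z)"
    and dm_le: "\<And>z x. z \<in> dm \<Longrightarrow> x \<in> carrier G \<Longrightarrow> x \<notin> dm \<Longrightarrow> pow_le G z x"
begin

text \<open>A twin \<open>y\<close> not below \<open>x\<close> lies strictly above it, and the
  criterion for twins applies with \<open>y\<close> itself as the upper bound. For
  \<open>x = \<one>\<close> the twins are the dominating vertices, whose orders are prime powers by
  assumption.\<close>

lemma twins_divisor_chain:
  assumes "x \<in> carrier G" "y \<in> tw x" "\<not> pow_le G y x"
  shows "divisor_chain (ord y)"
proof (cases "x = \<one>")
  case True
  then show ?thesis using assms(2) dominating_iff_twin_one[of y] dm_chain[of y] by simp
next
  case False
  have y: "y \<in> carrier G" using assms(2) by (rule twin_carrier)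
  have "pow_le G x y"
    using assms(3) twins_adj[OF assms(1) twins_refl[OF assms(1)] assms(2)] by (auto simp: pow_adj_def)
  then show ?thesis
    using divisor_chain_if_twins_le[OF assms(1,2) y _ assms(3) _ False] by simp
qed

text \<open>The hard inclusion is that a neighbour \<open>z\<close> of \<open>a\<close> is one of
  \<open>d\<close>. If \<open>b\<close> is below \<open>a\<close>, then \<open>d\<close> and
  \<open>a\<close> generate the same subgroup. Otherwise \<open>ord b\<close> is a prime power; as a
  neighbour of \<open>b\<close>, \<open>z\<close> is either above \<open>b\<close> and so above
  \<open>d\<close>, or below \<open>b\<close> in a chain together with \<open>d\<close>.\<close>

lemma twins_convex:
  assumes x: "x \<in> carrier G" and a: "a \<in> tw x" and b: "b \<in> tw x" and d: "d \<in> carrier G"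
    and "pow_le G a d" "pow_le G d b"
  shows "d \<in> tw x"
proof -
  have C: "a \<in> carrier G" "b \<in> carrier G" using a b twin_carrier by auto
  have ab: "b \<in> tw a" using twins_eq[OF a] b by simp
  have "pow_adj G d z \<longleftrightarrow> pow_adj G a z" if z: "z \<in> carrier G" for z
  proof
    assume "pow_adj G d z"
    then consider "pow_le G z b" | "pow_le G a z" 
      using pow_le_trans[OF assms(5), of z] pow_le_trans[OF _ assms(6), of z] by (auto simp: pow_adj_def)
    then show "pow_adj G a z"
    proof cases
      case 1
      then show ?thesis using twin_adj[OF ab z] by (auto simp: pow_adj_def)
    qed (simp add: pow_adj_def)
  next
    assume az: "pow_adj G a z"
    then have zb: "pow_adj G z b" using twin_adj[OF ab z] pow_adj_sym[OF az] by blast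
    show "pow_adj G d z"
    proof (cases "pow_le G b a")
      case True
      then show ?thesis 
        using az pow_le_trans[OF pow_le_trans[OF assms(6) True], of z] pow_le_trans[OF _ assms(5), of z]
        by (auto simp: pow_adj_def)
    next
      case False
      then have ch: "divisor_chain (ord b)" using twins_divisor_chain[OF C(1) ab] by simp
      show ?thesis
      proof (cases "pow_le G z b")
        case True
        then show ?thesis using pow_adj_if_divisor_chain[OF ch d z C(2) assms(6)] by simp
      next
        case False
        then show ?thesis using zb pow_le_trans[OF assms(6), of z] by (auto simp: pow_adj_def)
      qed
    qed
  qed
  then have "d \<in> tw a" using d by (simp add: twins_def)
  then show ?thesis using twins_eq[OF a] by simp
qed

text \<open>Otherwise \<open>y\<close>, a neighbour of \<open>x'\<close>, would lie between the
  twins \<open>x\<close> and \<open>x'\<close> and be a twin by convexity.\<close>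

lemma pow_le_twin_left:
  assumes "x \<in> carrier G" "y \<in> carrier G" "pow_le G x y" "y \<notin> tw x" "x' \<in> tw x"
  shows "pow_le G x' y"
proof (rule ccontr)
  assume n: "\<not> pow_le G x' y"
  have "pow_adj G y x'" using twin_adj[OF assms(5,2)] assms(3) by (simp add: pow_adj_def)
  then have "pow_le G y x'" using n by (auto simp: pow_adj_def)
  then show False
    using twins_convex[OF assms(1) twins_refl[OF assms(1)] assms(5,2,3)] assms(4) by simp
qed

text \<open>A strict containment between \<open>x\<close> and a twin, in either direction, would
  make \<open>ord x\<close> a divisor of a prime power.\<close>

lemma twins_eq_cyclic_class:
  assumes "x \<in> carrier G" "\<not> divisor_chain (ord x)"
  shows "tw x = cyclic_class G x"
proof
  show "tw x \<subseteq> cyclic_class G x"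
  proof
    fix y assume y: "y \<in> tw x"
    then have yC: "y \<in> carrier G" by (rule twin_carrier)
    have xy: "pow_le G x y"
      using twins_divisor_chain[OF yC twins_sym[OF assms(1) y]] assms(2) by blast
    moreover have "pow_le G y x"
      using twins_divisor_chain[OF assms(1) y] assms(2)
        divisor_chain_dvd[OF _ ord_dvd_if_pow_le[OF assms(1) yC xy]] by blast
    ultimately show "y \<in> cyclic_class G x" using yC cyclic_class_conv[OF assms(1)] by simp
  qed
qed (rule cyclic_class_subset_twins[OF assms(1)])

text \<open>Here \<open>ord x\<close> may well be a prime power; the obstruction is the element
  \<open>y\<close> above the class. All twins of \<open>x\<close> lie below \<open>y\<close>, so two
  of them generating different subgroups would make \<open>ord y\<close> a prime power.\<close>

lemma twins_eq_cyclic_class_below: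
  assumes "x \<in> carrier G" "y \<in> carrier G" "pow_le G x y" "y \<notin> tw x" "x \<notin> dm"
    and nch: "\<not> divisor_chain (ord y)"
  shows "tw x = cyclic_class G x"
proof
  show "tw x \<subseteq> cyclic_class G x"
  proof
    fix u assume u: "u \<in> tw x"
    then have uC: "u \<in> carrier G" by (rule twin_carrier)
    have uy: "pow_le G u y" using pow_le_twin_left[OF assms(1-4) u] .
    have ne: "x \<noteq> \<one>" "u \<noteq> \<one>"
      using assms(5) one_dominating dominating_twins[OF u assms(1)] by auto
    have adj: "pow_adj G x u" using twins_adj[OF assms(1) twins_refl[OF assms(1)] u] .
    have "pow_le G u x" "pow_le G x u"
      using divisor_chain_if_twins_le[OF assms(1) u assms(2) _ _ uy ne(1)]
        divisor_chain_if_twins_le[OF uC twins_sym[OF assms(1) u] assms(2) _ _ assms(3) ne(2)]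
        nch adj by (auto simp: pow_adj_def)
    then show "u \<in> cyclic_class G x" using uC cyclic_class_conv[OF assms(1)] by simp
  qed
qed (rule cyclic_class_subset_twins[OF assms(1)])

text \<open>If \<open>ord y\<close> is a prime power, the largest twin \<open>d\<close> of
  \<open>x\<close> separates the sizes:
  \<open>card (tw x) < ord d \<le> totient (ord y) \<le> card (tw y)\<close>. Otherwise, for
  \<open>x\<close> outside \<open>dm\<close>, both twin classes are cyclic classes, so their sizes
  are totients of orders dividing one another, and the only tie is \<open>ord y = 2 * ord x\<close>
  with \<open>ord x\<close> odd.\<close>

lemma twin_below_if_pow_le:
  assumes x: "x \<in> carrier G" and y: "y \<in> carrier G" and le: "pow_le G x y" and nt: "y \<notin> tw x"
  shows "twin_below (carrier G) (pow_adj G) x y"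
proof -
  \<comment> \<open>As \<open>dm\<close> is a single twin class, \<open>x\<close> would lie outside
    it and hence above \<open>y\<close>; with \<open>le\<close> both would generate the same
    subgroup.\<close>
  have ydm: "y \<notin> dm"
  proof
    assume "y \<in> dm"
    moreover from this have "x \<notin> dm" 
      using nt dominating_iff_twin_one twins_eq[of x "carrier G" "pow_adj G" \<one>] by blast
    ultimately have "pow_le G y x" using dm_le x by blast
    then have "y \<in> cyclic_class G x" using x y le cyclic_class_conv by simp
    then show False using nt cyclic_class_subset_twins[OF x] by blast
  qed
  have nle: "\<not> pow_le G y x"
    using nt cyclic_class_subset_twins[OF x] cyclic_class_conv[OF x] y le by blast
  have ne: "ord x \<noteq> ord y" using pow_le_if_ord_eq[OF x y le] nle by blast
  have main: "card (tw x) < card (tw y) \<or> card (tw x) = card (tw y) \<and>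
        (\<exists>t \<in> carrier G. card (tw t) = 1 \<and> pow_adj G t y \<and> \<not> pow_adj G t x)" if xdm: "x \<notin> dm"
  proof (cases "divisor_chain (ord y)")
    case True
    obtain d where d: "d \<in> tw x" "\<And>u. u \<in> tw x \<Longrightarrow> pow_le G u d" using twins_top[OF x] by blast
    have dC: "d \<in> carrier G" using d(1) by (rule twin_carrier)
    have dy: "pow_le G d y" using pow_le_twin_left[OF x y le nt d(1)] .
    have "\<not> pow_le G y d"
      using twins_convex[OF x twins_refl[OF x] d(1) y le] nt by blast
    then have "ord d \<noteq> ord y" using pow_le_if_ord_eq[OF dC y dy] by blast
    then have "ord d \<le> totient (ord y)"
      using proper_divisor_le_totient[OF True] ord_dvd_if_pow_le[OF dC y dy] y by simp
    also have "\<dots> \<le> card (tw y)"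
      using card_mono[OF finite_twins cyclic_class_subset_twins[OF y]] card_cyclic_class[OF y] by simp
    finally have "ord d \<le> card (tw y)" .
    \<comment> \<open>Strict because \<one> lies below \<open>d\<close> but, \<open>x\<close> being
      outside \<open>dm\<close>, is not a twin of \<open>x\<close>.\<close>
    moreover have "tw x \<subset> {w \<in> carrier G. pow_le G w d}"
    proof
      show "tw x \<subseteq> {w \<in> carrier G. pow_le G w d}" using d(2) twin_carrier[of _ x] by blast
      have "\<one> \<notin> tw x" 
        using xdm one_dominating dominating_twins[of \<one> "carrier G" "pow_adj G" x] x by blast
      moreover have "\<one> \<in> {w \<in> carrier G. pow_le G w d}" using dC by simp
      ultimately show "tw x \<noteq> {w \<in> carrier G. pow_le G w d}" by metis
    qed
    then have "card (tw x) < ord d"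
      unfolding ord_eq_card_pow_le[OF dC] by (intro psubset_card_mono) auto
    ultimately show ?thesis by linarith
  next
    case False
    have cx: "card (tw x) = totient (ord x)"
      using twins_eq_cyclic_class_below[OF x y le nt xdm False] card_cyclic_class[OF x] by simp
    have cy: "card (tw y) = totient (ord y)"
      using twins_eq_cyclic_class[OF y False] card_cyclic_class[OF y] by simp
    have dvd: "ord x dvd ord y" using ord_dvd_if_pow_le[OF x y le] .
    show ?thesis
    proof (cases "totient (ord x) = totient (ord y)")
      case True
      have odd: "odd (ord x)" and ord2: "ord y = 2 * ord x"
        using totient_eq_proper_divisor[OF dvd ord_pos[OF y] ne True] by auto
      \<comment> \<open>Below \<open>y\<close>, an element of order 2 is adjacent to none of odd
        order above 1, in particular not to \<open>x\<close>. Its twin class is its cyclic class, of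
        size \<open>totient 2 = 1\<close>.\<close>
      obtain t where t: "t \<in> carrier G" "pow_le G t y" "ord t = 2"
        using ex_pow_le_ord[OF y, of 2] ord2 by auto
      have "ord x \<noteq> 1" using xdm one_dominating ord_eq_1_iff[OF x] by auto
      then have "\<not> dvd_comparable (ord t) (ord x)"
        
        using odd t(3) prime_nat_iff[of 2] two_is_prime_nat by (auto simp: dvd_comparable_def)
      then have ntx: "\<not> pow_adj G t x"
        using pow_adj_iff_dvd_comparable[OF y t(1) x t(2) le] by blast
      have "t \<notin> dm" using ntx x by (auto simp: dominating_def)
      moreover have "y \<notin> tw t"
        using ntx twin_adj[of y t x] x le pow_adj_sym[of G x t] by (auto simp: pow_adj_def)
      ultimately have "tw t = cyclic_class G t"
        using twins_eq_cyclic_class_below[OF t(1) y t(2)] False by blast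
      then have "card (tw t) = 1" using card_cyclic_class[OF t(1)] t(3) by simp
      then show ?thesis using t ntx cx cy True by (auto simp: pow_adj_def)
    next
      case neq: False
      then show ?thesis using totient_dvd_mono[OF dvd] y cx cy by (simp add: order.not_eq_order_implies_strict)
    qed
  qed
  show ?thesis
    using ydm le nt main by (auto simp: twin_below_def pow_adj_def)
qed

text \<open>For the converse with \<open>x\<close> outside \<open>dm\<close>, suppose
  \<open>y\<close> lies below \<open>x\<close> but not conversely. The forward direction gives
  \<open>card (tw y) \<le> card (tw x)\<close>, which leaves only the tie clause with its witness
  \<open>t\<close>. Since \<open>t\<close> is adjacent to \<open>y\<close> but not to
  \<open>x\<close>, it lies strictly above \<open>y\<close>; its twin class has size 1, so
  \<open>ord t \<le> 2\<close>, which leaves no room for \<open>y\<close> strictly between \<one>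
  and \<open>t\<close>.\<close>

lemma twin_below_iff_pow_le:
  assumes x: "x \<in> carrier G" and y: "y \<in> carrier G"
  shows "twin_below (carrier G) (pow_adj G) x y \<longleftrightarrow> pow_le G x y \<and> y \<notin> tw x"
proof
  assume b: "twin_below (carrier G) (pow_adj G) x y"
  then have ydm: "y \<notin> dm" by (simp add: twin_below_def)
  show "pow_le G x y \<and> y \<notin> tw x"
  proof (cases "x \<in> dm")
    case True
    then show ?thesis 
      using dm_le[OF True y ydm] ydm dominating_twins[of y "carrier G" "pow_adj G" x] x by blast
  next
    case xdm: False
    then have adj: "pow_adj G x y" and nt: "y \<notin> tw x" using b by (auto simp: twin_below_def)
    have "pow_le G x y"
    proof (rule ccontr)
      assume "\<not> pow_le G x y"
      then have le: "pow_le G y x" using adj by (auto simp: pow_adj_def)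
      have "x \<notin> tw y" using nt twins_sym[OF y, of x "pow_adj G"] by blast
      then have "twin_below (carrier G) (pow_adj G) y x"
        using twin_below_if_pow_le[OF y x le] by blast
      then have "card (tw y) \<le> card (tw x)" using ydm by (auto simp: twin_below_def)
      then obtain t where t: "t \<in> carrier G" "card (tw t) = 1" "pow_adj G t y" "\<not> pow_adj G t x"
        using b xdm by (auto simp: twin_below_def)
      have nty: "\<not> pow_le G t y" using t(4) le pow_le_trans[of G t y x] by (auto simp: pow_adj_def)
      then have yt: "pow_le G y t" using t(3) by (auto simp: pow_adj_def)
      have "totient (ord t) \<le> 1"
        using card_mono[OF finite_twins cyclic_class_subset_twins[OF t(1)]] card_cyclic_class[OF t(1)] t(2)
        by simp
      then have "totient (ord t) = 1" 
        using totient_gt_0_iff[of "ord t"] ord_pos[OF t(1)] by linarith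
      then have "ord t = 1 \<or> ord t = 2" by (rule totient_eq_1_imp)
      moreover have "ord y dvd ord t" using ord_dvd_if_pow_le[OF y t(1) yt] .
      moreover have "ord y \<noteq> 1" using ydm one_dominating ord_eq_1_iff[OF y] by auto
      ultimately have "ord y = ord t" using prime_nat_iff[of 2] two_is_prime_nat by auto
      then show False using pow_le_if_ord_eq[OF y t(1) yt] nty by blast
    qed
    then show ?thesis using nt by blast
  qed
qed (use twin_below_if_pow_le assms in blast)

section \<open>Recovering orders from the twin classes\<close>

lemma ord_top_twins:
  assumes "c \<in> carrier G" and top: "\<And>y. y \<in> tw c \<Longrightarrow> pow_le G y c"
  shows "ord c = card (tw c) + card {w \<in> carrier G. twin_below (carrier G) (pow_adj G) w c}"
proof -
  have "{w \<in> carrier G. pow_le G w c} =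
    tw c \<union> {w \<in> carrier G. twin_below (carrier G) (pow_adj G) w c}"
    using top twin_carrier[of _ c] twin_below_iff_pow_le[OF _ assms(1)]
      twins_sym[of _ "carrier G" c "pow_adj G"] by blast
  moreover have "tw c \<inter> {w \<in> carrier G. twin_below (carrier G) (pow_adj G) w c} = {}"
    using twin_below_iff_pow_le[OF _ assms(1)]
      twins_sym[OF assms(1), of _ "pow_adj G"] by blast
  ultimately show ?thesis
    unfolding ord_eq_card_pow_le[OF assms(1)] by (simp add: card_Un_disjoint)
qed

text \<open>At a prime power order the elements below \<open>c\<close> are linearly preordered, and
  by convexity the twins of \<open>c\<close> form an upper segment. A twin \<open>x\<close> is above
  every non-twin below \<open>c\<close> and above itself, so \<open>ord x\<close> exceeds the number
  \<open>ord c - card (tw c)\<close> of these non-twins; below a non-twin there are only non-twins,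
  so its order does not. At other orders all twins of \<open>c\<close> generate the same
  subgroup.\<close>

lemma ord_twins:
  assumes c: "c \<in> carrier G" and top: "\<And>y. y \<in> tw c \<Longrightarrow> pow_le G y c"
  shows "ord ` tw c = (if divisor_chain (ord c) then {k. k dvd ord c \<and> ord c - card (tw c) < k}
    else {ord c})"
proof (cases "divisor_chain (ord c)")
  case True
  let ?D = "{w \<in> carrier G. pow_le G w c}"
  have sub: "tw c \<subseteq> ?D" using top twin_carrier[of _ c] by blast
  have cD: "card (?D - tw c) = ord c - card (tw c)"
    using sub ord_eq_card_pow_le[OF c] by (simp add: card_Diff_subset)
  have "k \<in> ord ` tw c \<longleftrightarrow> k dvd ord c \<and> ord c - card (tw c) < k" for k
  proof
    assume "k \<in> ord ` tw c"
    then obtain x where x: "x \<in> tw c" "k = ord x" by blast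
    have xC: "x \<in> carrier G" using x(1) by (rule twin_carrier)
    have "w \<in> carrier G \<and> pow_le G w x" if w: "w \<in> ?D - tw c" for w
    proof (rule ccontr)
      assume "\<not> (w \<in> carrier G \<and> pow_le G w x)"
      then have "pow_le G x w"
        using pow_adj_if_divisor_chain[OF True xC _ c top[OF x(1)]] w by (auto simp: pow_adj_def)
      then show False using twins_convex[OF c x(1) twins_refl[OF c]] w by blast
    qed
    then have "?D - tw c \<subset> {w \<in> carrier G. pow_le G w x}" using x xC by auto
    then have "card (?D - tw c) < ord x"
      unfolding ord_eq_card_pow_le[OF xC] by (intro psubset_card_mono) auto
    then show "k dvd ord c \<and> ord c - card (tw c) < k"
      using cD x ord_dvd_if_pow_le[OF xC c top[OF x(1)]] by simp
  next
    assume k: "k dvd ord c \<and> ord c - card (tw c) < k"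
    then obtain x where x: "x \<in> carrier G" "pow_le G x c" "ord x = k" using ex_pow_le_ord[OF c] by blast
    have "x \<in> tw c"
    proof (rule ccontr)
      assume n: "x \<notin> tw c"
      have "{w \<in> carrier G. pow_le G w x} \<subseteq> ?D - tw c"
        using pow_le_trans[OF _ x(2)] twins_convex[OF c _ twins_refl[OF c] x(1) _ x(2)] n by blast
      then have "ord x \<le> card (?D - tw c)"
        unfolding ord_eq_card_pow_le[OF x(1)] by (intro card_mono) auto
      then show False using cD x(3) k by simp
    qed
    then show "k \<in> ord ` tw c" using x(3) by blast
  qed
  then show ?thesis using True by auto
next
  case False
  have "ord ` tw c = {ord c}"
    using twins_eq_cyclic_class[OF c False] cyclic_class_eq_ord[OF c c] twins_refl[OF c, of "pow_adj G"] by auto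
  then show ?thesis using False by simp
qed

text \<open>All twins lie below one element, where elements of equal order generate the same
  subgroup. A twin of order \<open>k\<close> thus accounts for one whole cyclic class, which stays
  inside the twin class.\<close>

lemma card_twins_ord:
  assumes "x \<in> carrier G"
  shows "card {y \<in> tw x. ord y = k} = (if k \<in> ord ` tw x then totient k else 0)"
proof (cases "k \<in> ord ` tw x")
  case True
  then obtain u where u: "u \<in> tw x" "k = ord u" by blast
  have uC: "u \<in> carrier G" using u(1) by (rule twin_carrier)
  have tx: "tw x = tw u" using twins_eq[OF u(1)] by simp
  obtain c where c: "c \<in> tw u" "\<And>y. y \<in> tw u \<Longrightarrow> pow_le G y c" using twins_top[OF uC] by blast
  have cC: "c \<in> carrier G" using c(1) by (rule twin_carrier)
  have "{y \<in> tw x. ord y = k} = cyclic_class G u"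
    using cyclic_class_eq_ord[OF cC uC c(2)[OF twins_refl[OF uC]]] c(2) twin_carrier[of _ u]
      cyclic_class_subset_twins[OF uC] unfolding tx u(2) by blast
  then show ?thesis using card_cyclic_class[OF uC] u True by simp
next
  case False
  then have "{y \<in> tw x. ord y = k} = {}" by auto
  then show ?thesis using False by (metis card.empty)
qed

lemma pow_le_iff_twin:
  assumes x: "x \<in> carrier G" and y: "y \<in> carrier G"
  shows "pow_le G x y \<longleftrightarrow>
    twin_below (carrier G) (pow_adj G) x y \<or> (y \<in> tw x \<and> ord x dvd ord y)"
proof (cases "y \<in> tw x")
  case True
  obtain c where c: "c \<in> tw x" "\<And>y. y \<in> tw x \<Longrightarrow> pow_le G y c" using twins_top[OF x] by blast
  then show ?thesis
    using True pow_le_iff_ord_dvd[OF twin_carrier[OF c(1)] x y] twins_refl[OF x] twin_below_iff_pow_le[OF x y]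
    by blast
qed (use twin_below_iff_pow_le[OF x y] in blast)

end

section \<open>From the power graph to the power digraph\<close>

context fin_group
begin

text \<open>The Sylow theorem with exponent 1 supplies an element of order \<open>q\<close> for
  every prime \<open>q\<close> dividing the group order. It is adjacent to \<open>z\<close>, whose
  order is a nontrivial power of \<open>p\<close>, so \<open>q = p\<close>.\<close>

lemma divisor_chain_order_if_dominating:
  assumes z: "z \<in> dm" "z \<noteq> \<one>" and ch: "divisor_chain (ord z)"
  shows "divisor_chain (order G)"
proof -
  have zC: "z \<in> carrier G" and adj: "\<And>x. x \<in> carrier G \<Longrightarrow> pow_adj G z x"
    using z by (auto simp: dominating_def)
  have "ord z > 1" using ord_pos[OF zC] ord_eq_1_iff[OF zC] z(2) by linarith
  then obtain p k where p: "prime p" "ord z = p ^ k" "k > 0" using divisor_chainE[OF ch] by blast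
  have "q = p" if q: "prime q" "q dvd order G" for q
  proof -
    obtain m where "order G = q ^ 1 * m" using q(2) by auto
    then obtain H where H: "subgroup H G" "card H = q"
      using sylow_thm[OF q(1) is_group _ fin, of 1 m] by auto
    have "\<not> H \<subseteq> {\<one>}"
    proof
      assume "H \<subseteq> {\<one>}"
      then have "card H \<le> card {\<one>}" by (intro card_mono) auto
      then show False using H(2) prime_gt_1_nat[OF q(1)] by simp
    qed
    then obtain h where h: "h \<in> H" "h \<noteq> \<one>" by blast
    have hC: "h \<in> carrier G" using subgroup.mem_carrier[OF H(1) h(1)] .
    interpret S: group "G\<lparr>carrier := H\<rparr>" using H(1) by (rule subgroup_imp_group)
    have "h [^]\<^bsub>G\<lparr>carrier := H\<rparr>\<^esub> order (G\<lparr>carrier := H\<rparr>) = \<one>\<^bsub>G\<lparr>carrier := H\<rparr>\<^esub>"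
      by (rule S.pow_order_eq_1) (simp add: h)
    then have "h [^] q = \<one>" using H(2) nat_pow_consistent[of h q H] by (simp add: order_def)
    then have "ord h dvd q" using hC by (simp add: pow_eq_id)
    then have "ord h = q" using q(1) ord_eq_1[OF hC] h(2) by (metis prime_nat_iff)
    then have "q dvd p ^ k \<or> p ^ k dvd q"
      using adj[OF hC] ord_dvd_if_pow_le[OF zC hC] ord_dvd_if_pow_le[OF hC zC] p(2)
      by (auto simp: pow_adj_def)
    then have "q dvd p \<or> p dvd q"
      using p(3) q(1) by (meson dvd_power dvd_trans prime_dvd_power)
    then show ?thesis using p(1) q(1) primes_dvd_imp_eq by metis
  qed
  moreover have "order G > 0" using fin by (simp add: order_gt_0_iff_finite)
  ultimately show ?thesis
    using prime_power_if_unique_prime[OF p(1)] divisor_chain_prime_power[OF p(1)] by metis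
qed

lemma card_ord_eq_if_cyclic:
  assumes z: "z \<in> carrier G" and top: "\<And>x. x \<in> carrier G \<Longrightarrow> pow_le G x z"
  shows "card {x \<in> carrier G. ord x = k} = (if k dvd order G then totient k else 0)"
proof -
  have oz: "ord z = order G"
  proof -
    have "{x \<in> carrier G. pow_le G x z} = carrier G" using top by blast
    then show ?thesis by (simp add: ord_eq_card_pow_le[OF z] order_def)
  qed
  show ?thesis
  proof (cases "k dvd order G")
    case True
    then obtain x where x: "x \<in> carrier G" "pow_le G x z" "ord x = k"
      using ex_pow_le_ord[OF z, of k] oz by auto
    have "{y \<in> carrier G. ord y = k} = {y \<in> carrier G. pow_le G y z \<and> ord y = ord x}"
      using top x(3) by auto
    then show ?thesis
      using cyclic_class_eq_ord[OF z x(1,2)] card_cyclic_class[OF x(1)] x(3) True by simp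
  next
    case False
    then have "{x \<in> carrier G. ord x = k} = {}" using ord_dvd_group_order by auto
    then show ?thesis using False by (metis card.empty)
  qed
qed

text \<open>The cyclic alternative records a group order that is not a prime power together with a
  nontrivial \<open>dm\<close>, the combination that the central alternative cannot have.\<close>

lemma central_or_cyclic:
  obtains "fin_group_central G"
  | z where "z \<in> carrier G" "\<And>x. x \<in> carrier G \<Longrightarrow> pow_le G x z" "\<not> divisor_chain (order G)" "dm \<noteq> {\<one>}"
proof (cases "\<exists>z \<in> carrier G. (\<forall>x \<in> carrier G. pow_le G x z) \<and> \<not> divisor_chain (ord z)")
  case True
  then obtain z where z: "z \<in> carrier G" "\<And>x. x \<in> carrier G \<Longrightarrow> pow_le G x z" "\<not> divisor_chain (ord z)"
    by blast
  have "{x \<in> carrier G. pow_le G x z} = carrier G" using z(2) by blast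
  then have "ord z = order G" by (simp add: ord_eq_card_pow_le[OF z(1)] order_def)
  moreover have "z \<in> dm" using z by (simp add: dominating_def pow_adj_def)
  moreover have "z \<noteq> \<one>" using z(3) by auto
  ultimately show ?thesis using that(2)[OF z(1,2)] z(3) by auto
next
  case False
  then have "\<forall>z \<in> dm. divisor_chain (ord z) \<and> (\<forall>x \<in> carrier G - dm. pow_le G z x)"
    using dominating_dichotomy by blast
  then show ?thesis
    using fin_group_axioms by (intro that(1)) (simp add: fin_group_central_def fin_group_central_axioms_def)
qed

lemma divisor_chain_order_if_central:
  assumes "fin_group_central G" "dm \<noteq> {\<one>}"
  shows "divisor_chain (order G)"
proof -
  interpret fin_group_central G by fact
  obtain z where "z \<in> dm" "z \<noteq> \<one>" using assms(2) one_dominating by blast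
  then show ?thesis using divisor_chain_order_if_dominating dm_chain by blast
qed

end

section \<open>Isomorphisms of relations determined by keys\<close>

definition rel_iso :: "'a set \<Rightarrow> ('a \<Rightarrow> 'a \<Rightarrow> bool) \<Rightarrow> 'b set \<Rightarrow> ('b \<Rightarrow> 'b \<Rightarrow> bool) \<Rightarrow> bool" where
  "rel_iso V R W S \<longleftrightarrow> (\<exists>f. bij_betw f V W \<and> (\<forall>x \<in> V. \<forall>y \<in> V. R x y \<longleftrightarrow> S (f x) (f y)))"

text \<open>When the keys of two elements decide how they are related, any bijection that preserves
  keys is an isomorphism. Only the sizes of the fibres have to be compared, never a particular
  choice inside a fibre.\<close>

lemma rel_iso_by_key:
  assumes "finite V" "finite W"
    and "\<And>k. card {x \<in> V. \<kappa> x = k} = card {y \<in> W. \<mu> y = k}"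
    and "\<And>x y x' y'. x \<in> V \<Longrightarrow> y \<in> V \<Longrightarrow> x' \<in> W \<Longrightarrow> y' \<in> W \<Longrightarrow> \<mu> x' = \<kappa> x \<Longrightarrow> \<mu> y' = \<kappa> y \<Longrightarrow>
      R x y \<longleftrightarrow> S x' y'"
  shows "rel_iso V R W S"
proof -
  obtain g where g: "bij_betw g V W" "\<And>x. x \<in> V \<Longrightarrow> \<mu> (g x) = \<kappa> x"
    using bij_betw_of_equal_fibers[of V W \<kappa> \<mu>, OF assms(1-3)] by blast
  have "R x y \<longleftrightarrow> S (g x) (g y)" if "x \<in> V" "y \<in> V" for x y
    by (rule assms(4)) (use that g(2) bij_betw_apply[OF g(1)] in auto)
  then show ?thesis unfolding rel_iso_def using g(1) by blast
qed

text \<open>Below a generator the order is a sufficient key, and the number of elements of each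
  order depends only on the group order.\<close>

lemma pow_le_iso_if_cyclic:
  assumes "fin_group G" "fin_group H" "card (carrier G) = card (carrier H)"
    and z: "z \<in> carrier G" "\<And>x. x \<in> carrier G \<Longrightarrow> pow_le G x z"
    and w: "w \<in> carrier H" "\<And>x. x \<in> carrier H \<Longrightarrow> pow_le H x w"
  shows "rel_iso (carrier G) (pow_le G) (carrier H) (pow_le H)"
proof -
  interpret G: fin_group G by fact
  interpret H: fin_group H by fact
  show ?thesis
  proof (rule rel_iso_by_key[where \<kappa> = "G.ord" and \<mu> = "H.ord"])
    show "card {x \<in> carrier G. G.ord x = k} = card {y \<in> carrier H. H.ord y = k}" for k
      using G.card_ord_eq_if_cyclic[OF z, of k] H.card_ord_eq_if_cyclic[OF w, of k] assms(3)
      by (simp add: order_def)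
    fix x y x' y'
    assume "x \<in> carrier G" "y \<in> carrier G" "x' \<in> carrier H" "y' \<in> carrier H"
      "H.ord x' = G.ord x" "H.ord y' = G.ord y"
    then show "pow_le G x y \<longleftrightarrow> pow_le H x' y'"
      using G.pow_le_iff_ord_dvd[OF z(1) _ _ z(2) z(2)] H.pow_le_iff_ord_dvd[OF w(1) _ _ w(2) w(2)] by simp
  qed simp_all
qed

lemma pow_le_iso_if_central:
  fixes G :: "('a, 'm) monoid_scheme" and H :: "('b, 'n) monoid_scheme"
  assumes "fin_group_central G" "fin_group_central H"
    and "graph_isomorphism (carrier G) (pow_adj G) (carrier H) (pow_adj H) f"
  shows "rel_iso (carrier G) (pow_le G) (carrier H) (pow_le H)"
proof -
  interpret G: fin_group_central G by fact
  interpret H: fin_group_central H by fact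
  interpret graph_isomorphism "carrier G" "pow_adj G" "carrier H" "pow_adj H" f by fact
  let ?bG = "twin_below (carrier G) (pow_adj G)" and ?bH = "twin_below (carrier H) (pow_adj H)"
  have ords: "H.ord ` H.tw (f x) = G.ord ` G.tw x" if x: "x \<in> carrier G" for x
  proof -
    obtain c where c: "c \<in> G.tw x" "\<And>y. y \<in> G.tw x \<Longrightarrow> pow_le G y c" using G.twins_top[OF x] by blast
    obtain d where d: "d \<in> H.tw (f x)" "\<And>y. y \<in> H.tw (f x) \<Longrightarrow> pow_le H y d"
      using H.twins_top[OF f_in[OF x]] by blast
    have C: "c \<in> carrier G" "d \<in> carrier H" using G.twin_carrier[OF c(1)] H.twin_carrier[OF d(1)] by auto
    have tc: "G.tw x = G.tw c" and td: "H.tw (f x) = H.tw d"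
      using twins_eq[OF c(1)] twins_eq[OF d(1)] by auto
    have card: "card (H.tw d) = card (G.tw c)" using card_twins[OF x] tc td by simp
    \<comment> \<open>The image of the largest twin \<open>c\<close> need not be the largest twin
      \<open>d\<close> on the other side. It is a twin of \<open>d\<close>, which is enough to carry
      over the number of elements below.\<close>
    have "f c \<in> H.tw (f x)" using twins_image_iff[OF x C(1)] c(1) by simp
    then have dc: "d \<in> H.tw (f c)" using twins_eq d(1) by metis
    have "{w \<in> carrier H. ?bH w d} = f ` {w \<in> carrier G. ?bG w c}"
    proof -
      have "?bH (f w) d \<longleftrightarrow> ?bG w c" if w: "w \<in> carrier G" for w
        using twin_below_iff[OF w C(1)]
          twin_below_twins[OF pow_adj_sym f_in[OF w] f_in[OF C(1)] twins_refl[OF f_in[OF w]] dc] by simp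
      then show ?thesis unfolding W_eq by blast
    qed
    then have "card {w \<in> carrier H. ?bH w d} = card {w \<in> carrier G. ?bG w c}"
      using bij by (simp add: card_image bij_betw_def inj_on_def)
    then have "H.ord d = G.ord c"
      using G.ord_top_twins[OF C(1)] H.ord_top_twins[OF C(2)] c(2) d(2) card tc td by simp
    then show ?thesis
      using G.ord_twins[OF C(1)] H.ord_twins[OF C(2)] c(2) d(2) card tc td by simp
  qed
  show ?thesis
  \<comment> \<open>The first component keeps each element in the twin class chosen by
    \<open>f\<close>; the second corrects \<open>f\<close> inside that class so that orders
    agree.\<close>
  proof (rule rel_iso_by_key[where \<kappa> = "\<lambda>x. (f ` G.tw x, G.ord x)" and \<mu> = "\<lambda>y. (H.tw y, H.ord y)"])
    fix K :: "'b set \<times> nat"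
    obtain T k where K: "K = (T, k)" by fastforce
    show "card {x \<in> carrier G. (f ` G.tw x, G.ord x) = K} = card {y \<in> carrier H. (H.tw y, H.ord y) = K}"
    proof (cases "\<exists>x \<in> carrier G. f ` G.tw x = T")
      case True
      then obtain x where x: "x \<in> carrier G" "f ` G.tw x = T" by blast
      have T: "T = H.tw (f x)" using twins_image[OF x(1)] x(2) by simp
      have "f ` G.tw y = T \<longleftrightarrow> y \<in> G.tw x" if y: "y \<in> carrier G" for y
        unfolding T twins_image[OF y, symmetric]
        using twins_image_iff[OF x(1) y] twins_eq_iff[OF f_in[OF y], of "pow_adj H" "f x"] by auto
      then have 1: "{y \<in> carrier G. (f ` G.tw y, G.ord y) = K} = {y \<in> G.tw x. G.ord y = k}"
        using G.twin_carrier[of _ x] unfolding K by blast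
      have "H.tw y = T \<longleftrightarrow> y \<in> H.tw (f x)" if y: "y \<in> carrier H" for y
        unfolding T using twins_eq_iff[OF y, of "pow_adj H" "f x"] by auto
      then have 2: "{y \<in> carrier H. (H.tw y, H.ord y) = K} = {y \<in> H.tw (f x). H.ord y = k}"
        using H.twin_carrier[of _ "f x"] unfolding K by blast
      show ?thesis
        unfolding 1 2 G.card_twins_ord[OF x(1)] H.card_twins_ord[OF f_in[OF x(1)]] ords[OF x(1)] ..
    next
      case False
      then have 1: "{x \<in> carrier G. (f ` G.tw x, G.ord x) = K} = {}" unfolding K by blast
      have "H.tw y \<noteq> T" if y: "y \<in> carrier H" for y
      proof -
        obtain x where "x \<in> carrier G" "y = f x" using y unfolding W_eq by auto
        then show ?thesis using False twins_image[of x] by blast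
      qed
      then have 2: "{y \<in> carrier H. (H.tw y, H.ord y) = K} = {}" unfolding K by blast
      show ?thesis unfolding 1 2 by simp
    qed
  next
    fix x y x' y'
    assume x: "x \<in> carrier G" and y: "y \<in> carrier G" and x': "x' \<in> carrier H" and y': "y' \<in> carrier H"
      and kx: "(H.tw x', H.ord x') = (f ` G.tw x, G.ord x)"
      and ky: "(H.tw y', H.ord y') = (f ` G.tw y, G.ord y)"
    have tx: "H.tw x' = H.tw (f x)" and ty: "H.tw y' = H.tw (f y)"
      using kx ky twins_image x y by auto
    have mx: "x' \<in> H.tw (f x)" and my: "y' \<in> H.tw (f y)"
      using tx ty twins_refl[OF x'] twins_refl[OF y'] by auto
    have "?bH x' y' \<longleftrightarrow> ?bG x y"
      using twin_below_twins[OF pow_adj_sym f_in[OF x] f_in[OF y] mx my] twin_below_iff[OF x y] by simp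
    moreover have "y' \<in> H.tw x' \<longleftrightarrow> y \<in> G.tw x"
      using twins_eq_iff[OF y', of "pow_adj H" x'] twins_eq_iff[OF f_in[OF y], of "pow_adj H" "f x"]
        twins_image_iff[OF x y] tx ty by metis
    ultimately show "pow_le G x y \<longleftrightarrow> pow_le H x' y'"
      unfolding G.pow_le_iff_twin[OF x y] H.pow_le_iff_twin[OF x' y'] using kx ky by simp
  qed simp_all
qed

text \<open>A mixed pair is impossible: the cyclic side has nontrivial \<open>dm\<close>, the graph
  isomorphism transports this, and the central side would then have prime power order, against the
  equal order of the cyclic side.\<close>

lemma pow_le_iso_if_pow_adj_iso:
  assumes "fin_group G" "fin_group H"
    and "rel_iso (carrier G) (pow_adj G) (carrier H) (pow_adj H)"
  shows "rel_iso (carrier G) (pow_le G) (carrier H) (pow_le H)"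
proof -
  interpret G: fin_group G by fact
  interpret H: fin_group H by fact
  obtain f where f: "graph_isomorphism (carrier G) (pow_adj G) (carrier H) (pow_adj H) f"
    using assms(3) by (auto simp: rel_iso_def graph_isomorphism_def)
  interpret graph_isomorphism "carrier G" "pow_adj G" "carrier H" "pow_adj H" f by (rule f)
  have ord_eq: "order G = order H" using bij_betw_same_card[OF bij] by (simp add: order_def)
  have "H.dm = f ` G.dm"
    using dominating_iff unfolding W_eq by (auto simp: dominating_def)
  moreover have "inj_on f G.dm" using bij by (auto simp: bij_betw_def dominating_def inj_on_def)
  ultimately have "card H.dm = card G.dm" by (simp add: card_image)
  moreover have "G.dm = {\<one>\<^bsub>G\<^esub>} \<longleftrightarrow> card G.dm = 1" "H.dm = {\<one>\<^bsub>H\<^esub>} \<longleftrightarrow> card H.dm = 1"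
    using G.one_dominating H.one_dominating by (auto simp: card_1_singleton_iff)
  ultimately have dm: "G.dm = {\<one>\<^bsub>G\<^esub>} \<longleftrightarrow> H.dm = {\<one>\<^bsub>H\<^esub>}" by simp
  show ?thesis
  proof (cases rule: G.central_or_cyclic)
    case Gc: 1
    show ?thesis
    proof (cases rule: H.central_or_cyclic)
      case 1
      then show ?thesis using pow_le_iso_if_central[OF Gc _ f] by blast
    next
      case (2 w)
      then show ?thesis using G.divisor_chain_order_if_central[OF Gc] dm ord_eq by simp
    qed
  next
    case Gz: (2 z)
    show ?thesis
    proof (cases rule: H.central_or_cyclic)
      case 1
      then show ?thesis using H.divisor_chain_order_if_central dm ord_eq Gz by simp
    next
      case (2 w)
      then show ?thesis
        using pow_le_iso_if_cyclic[OF assms(1,2) _ Gz(1,2)] ord_eq by (simp add: order_def)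
    qed
  qed
qed

section \<open>The posets\<close>

text \<open>Ranks make the arbitrary linear orders of two groups comparable. For a reflexive
  \<open>r\<close> each element counts itself, so the ranks run through \<open>1..card S\<close>,
  each taken once.\<close>

definition order_rank :: "'a rel \<Rightarrow> 'a set \<Rightarrow> 'a \<Rightarrow> nat" where
  "order_rank r S x = card {y \<in> S. (y, x) \<in> r}"

lemma order_rank_le_iff:
  assumes "linear_order_on S r" "finite S" "x \<in> S" "y \<in> S"
  shows "order_rank r S x \<le> order_rank r S y \<longleftrightarrow> (x, y) \<in> r"
proof -
  have refl: "(u, u) \<in> r" if "u \<in> S" for u
    using assms(1) that by (auto simp: order_on_defs refl_on_def)
  have tr: "(u, w) \<in> r" if "(u, v) \<in> r" "(v, w) \<in> r" for u v w
    using assms(1) that by (auto simp: order_on_defs dest: transD)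
  show ?thesis
  proof
    assume "(x, y) \<in> r"
    then show "order_rank r S x \<le> order_rank r S y"
      unfolding order_rank_def using assms(2) by (intro card_mono) (auto intro: tr)
  next
    assume le: "order_rank r S x \<le> order_rank r S y"
    show "(x, y) \<in> r"
    proof (rule ccontr)
      assume n: "(x, y) \<notin> r"
      then have "(y, x) \<in> r"
        using assms refl by (cases "x = y") (auto simp: order_on_defs total_on_def)
      then have "{u \<in> S. (u, y) \<in> r} \<subseteq> {u \<in> S. (u, x) \<in> r}" by (auto intro: tr)
      moreover have "x \<in> {u \<in> S. (u, x) \<in> r} - {u \<in> S. (u, y) \<in> r}" using n refl assms by auto
      ultimately have "order_rank r S y < order_rank r S x"
        unfolding order_rank_def using assms(2) by (intro psubset_card_mono) auto
      then show False using le by simp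
    qed
  qed
qed

lemma card_order_rank_eq:
  assumes "linear_order_on S r" "finite S"
  shows "card {x \<in> S. order_rank r S x = k} = (if k \<in> {1..card S} then 1 else 0)"
proof -
  have inj: "inj_on (order_rank r S) S"
  proof (rule inj_onI)
    fix x y assume xy: "x \<in> S" "y \<in> S" "order_rank r S x = order_rank r S y"
    then have "(x, y) \<in> r" "(y, x) \<in> r" using order_rank_le_iff[OF assms] by (metis order_refl)+
    then show "x = y" using assms(1) by (auto simp: order_on_defs dest: antisymD)
  qed
  have "order_rank r S ` S \<subseteq> {1..card S}"
  proof
    fix k assume "k \<in> order_rank r S ` S"
    then obtain x where x: "x \<in> S" "k = order_rank r S x" by blast
    have "x \<in> {y \<in> S. (y, x) \<in> r}" using assms(1) x(1) by (auto simp: order_on_defs refl_on_def)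
    then have "k > 0" unfolding x(2) order_rank_def using assms(2) by (auto simp: card_gt_0_iff)
    moreover have "k \<le> card S" unfolding x(2) order_rank_def using assms(2) by (intro card_mono) auto
    ultimately show "k \<in> {1..card S}" by simp
  qed
  then have im: "order_rank r S ` S = {1..card S}"
    using card_image[OF inj] by (intro card_subset_eq) auto
  show ?thesis
  proof (cases "k \<in> {1..card S}")
    case True
    then obtain x where x: "x \<in> S" "order_rank r S x = k" using im by (metis imageE)
    then have "{y \<in> S. order_rank r S y = k} = {x}" using inj by (auto simp: inj_on_def)
    then show ?thesis using True by simp
  next
    case False
    then have "{x \<in> S. order_rank r S x = k} = {}" using im by blast
    then show ?thesis using False by (metis card.empty)
  qed
qed

context fin_group
begin

lemma cyclic_class_eq_iff:
  assumes "x \<in> carrier G" "y \<in> carrier G"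
  shows "cyclic_class G x = cyclic_class G y \<longleftrightarrow> pow_le G x y \<and> pow_le G y x"
proof
  have "x \<in> cyclic_class G x" using assms(1) by (simp add: cyclic_class_conv)
  then show "pow_le G x y \<and> pow_le G y x" if "cyclic_class G x = cyclic_class G y"
    unfolding that cyclic_class_conv[OF assms(2)] by simp
  assume "pow_le G x y \<and> pow_le G y x"
  then have "generate G {x} = generate G {y}" by (auto simp: pow_le_def)
  then show "cyclic_class G x = cyclic_class G y" by (simp add: cyclic_class_def)
qed

text \<open>Between different classes only strict containment of subgroups matters, so the quotient
  is independent of the chosen orders \<open>r\<close>.\<close>

lemma quotient_le_iff:
  assumes "x \<in> carrier G" "y \<in> carrier G"
  shows "le (quotient_poset G r) (cyclic_class G x) (cyclic_class G y) \<longleftrightarrow> pow_le G x y"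
proof
  assume "le (quotient_poset G r) (cyclic_class G x) (cyclic_class G y)"
  moreover have "x \<in> cyclic_class G x" "y \<in> cyclic_class G y"
    using assms by (auto simp: cyclic_class_iff)
  ultimately have "cyclic_class G x = cyclic_class G y \<or> cyc_less G r x y"
    by (auto simp: quotient_poset_def)
  then show "pow_le G x y"
    using cyclic_class_eq_iff[OF assms] cyc_less_iff[OF assms] by (auto simp: pow_le_def)
next
  assume le: "pow_le G x y"
  show "le (quotient_poset G r) (cyclic_class G x) (cyclic_class G y)"
  proof (cases "pow_le G y x")
    case True
    then show ?thesis using le cyclic_class_eq_iff[OF assms] by (simp add: quotient_poset_def)
  next
    case False
    then have "generate G {x} \<subset> generate G {y}" using le by (auto simp: pow_le_def)
    then have "cyc_less G r u v" if "u \<in> cyclic_class G x" "v \<in> cyclic_class G y" for u v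
      using that by (auto simp: cyc_less_def cyclic_class_def)
    then show ?thesis by (simp add: quotient_poset_def)
  qed
qed

lemma class_linear_order:
  assumes "class_ordering G r" "x \<in> carrier G"
  shows "linear_order_on (cyclic_class G x) (r (cyclic_class G x))"
  using assms by (auto simp: class_ordering_def cyclic_classes_def)

lemma finite_cyclic_class [simp]: "x \<in> carrier G \<Longrightarrow> finite (cyclic_class G x)"
  by (rule finite_subset[OF _ fin]) (auto simp: cyclic_class_iff)

text \<open>A lexicographic description: containment first, rank inside a class second. Both parts
  are determined by the class and the rank, which later serve as key.\<close>

lemma cyc_poset_le_iff:
  assumes "class_ordering G r" "x \<in> carrier G" "y \<in> carrier G"
  shows "le (cyc_poset G r) x y \<longleftrightarrow> pow_le G x y \<and>
    (cyclic_class G x = cyclic_class G y \<longrightarrow>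
      order_rank (r (cyclic_class G x)) (cyclic_class G x) x \<le> order_rank (r (cyclic_class G y)) (cyclic_class G y) y)"
proof (cases "cyclic_class G x = cyclic_class G y")
  case True
  let ?S = "cyclic_class G y"
  have "x \<in> ?S" "y \<in> ?S" 
    using True cyclic_class_eq_iff[OF assms(2,3)] cyclic_class_conv[OF assms(3)] assms(2,3) by auto
  then have "order_rank (r ?S) ?S x \<le> order_rank (r ?S) ?S y \<longleftrightarrow> (x, y) \<in> r ?S"
    using order_rank_le_iff[OF class_linear_order[OF assms(1,3)]] assms(3) by simp
  moreover have "generate G {x} = generate G {y}" using True cyclic_class_eq_iff[OF assms(2,3)] by (auto simp: pow_le_def)
  moreover have "(x, x) \<in> r ?S" using class_linear_order[OF assms(1,3)] \<open>x \<in> ?S\<close>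
    by (auto simp: order_on_defs refl_on_def)
  ultimately show ?thesis
    using True cyc_less_iff[OF assms(2,3), of r] by (auto simp: cyc_poset_def pow_le_def)
next
  case False
  then show ?thesis
    using cyclic_class_eq_iff[OF assms(2,3)] cyc_less_iff[OF assms(2,3), of r]
    by (auto simp: cyc_poset_def pow_le_def)
qed

text \<open>The power graph is the comparability graph of the poset: the chosen orders are total, so
  all pairs inside a cyclic class are comparable whichever orders are taken.\<close>

lemma pow_adj_iff_cyc_poset:
  assumes "class_ordering G r" "x \<in> carrier G" "y \<in> carrier G"
  shows "pow_adj G x y \<longleftrightarrow> le (cyc_poset G r) x y \<or> le (cyc_poset G r) y x"
  using cyclic_class_eq_iff[OF assms(2,3)] linear
  unfolding cyc_poset_le_iff[OF assms] cyc_poset_le_iff[OF assms(1,3,2)] pow_adj_def by metis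

lemma power_graph_wf: "pair_wf_digraph (power_graph G)"
  and power_digraph_wf: "pair_wf_digraph (power_digraph G)"
  and order_digraph_wf: "pair_wf_digraph (order_digraph G r)"
  by (auto simp: pair_wf_digraph_def power_graph_def power_digraph_def order_digraph_def)

lemma power_graph_arc:
  "x \<in> carrier G \<Longrightarrow> y \<in> carrier G \<Longrightarrow> (x, y) \<in> parcs (power_graph G) \<longleftrightarrow> x \<noteq> y \<and> pow_adj G x y"
  using is_power_of_iff_pow_le[of x y] is_power_of_iff_pow_le[of y x] by (simp add: power_graph_def pow_adj_def)

lemma power_digraph_arc:
  "x \<in> carrier G \<Longrightarrow> y \<in> carrier G \<Longrightarrow> (x, y) \<in> parcs (power_digraph G) \<longleftrightarrow> x \<noteq> y \<and> pow_le G y x"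
  using is_power_of_iff_pow_le[of y x] by (simp add: power_digraph_def)

lemma order_digraph_arc:
  "x \<in> carrier G \<Longrightarrow> y \<in> carrier G \<Longrightarrow>
    (x, y) \<in> parcs (order_digraph G r) \<longleftrightarrow> x \<noteq> y \<and> le (cyc_poset G r) y x"
  by (auto simp: order_digraph_def cyc_poset_def cyc_less_def)

end

section \<open>Passing between digraphs, posets and the quotient\<close>

text \<open>Arcs point downwards, hence the swapped arguments of \<open>R\<close> and
  \<open>S\<close>. On the diagonal the digraphs have no arcs, and reflexivity of both relations
  takes over.\<close>

lemma digraph_iso_iff_rel_iso:
  assumes "pair_wf_digraph P" "pair_wf_digraph Q" "pverts P = V" "pverts Q = W"
    and "\<And>x y. x \<in> V \<Longrightarrow> y \<in> V \<Longrightarrow> (x, y) \<in> parcs P \<longleftrightarrow> x \<noteq> y \<and> R y x"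
    and "\<And>x y. x \<in> W \<Longrightarrow> y \<in> W \<Longrightarrow> (x, y) \<in> parcs Q \<longleftrightarrow> x \<noteq> y \<and> S y x"
    and "\<And>x. x \<in> V \<Longrightarrow> R x x" "\<And>x. x \<in> W \<Longrightarrow> S x x"
  shows "digraph_iso (with_proj P) (with_proj Q) \<longleftrightarrow> rel_iso V R W S"
proof -
  have "(\<forall>x \<in> V. \<forall>y \<in> V. (x, y) \<in> parcs P \<longleftrightarrow> (f x, f y) \<in> parcs Q) \<longleftrightarrow>
    (\<forall>x \<in> V. \<forall>y \<in> V. R x y \<longleftrightarrow> S (f x) (f y))" if f: "bij_betw f V W" for f
  proof -
    have fW: "f x \<in> W" if "x \<in> V" for x using bij_betwE[OF f] that by blast
    have inj: "f x = f y \<longleftrightarrow> x = y" if "x \<in> V" "y \<in> V" for x y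
      using f that by (auto simp: bij_betw_def inj_on_def)
    have "((x, y) \<in> parcs P \<longleftrightarrow> (f x, f y) \<in> parcs Q) \<longleftrightarrow> (R y x \<longleftrightarrow> S (f y) (f x))"
      if "x \<in> V" "y \<in> V" for x y
      using that assms(5)[OF that] assms(6)[OF fW fW, OF that] assms(7) assms(8)[OF fW] inj by (cases "x = y") auto
    then show ?thesis by blast
  qed
  then show ?thesis
    unfolding digraph_iso_with_proj_iff[OF assms(1,2)] rel_iso_def assms(3,4) by blast
qed

lemma quotient_iso_if_pow_le_iso:
  assumes "fin_group G" "fin_group H"
    and "rel_iso (carrier G) (pow_le G) (carrier H) (pow_le H)"
  shows "\<exists>\<tau>. poset_isomorphism (quotient_poset G r) (quotient_poset H s) \<tau> \<and>
    (\<forall>S \<in> cyclic_classes G. card (\<tau> S) = card S)"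
proof -
  interpret G: fin_group G by fact
  interpret H: fin_group H by fact
  obtain g where g: "bij_betw g (carrier G) (carrier H)"
    and iso: "\<And>x y. x \<in> carrier G \<Longrightarrow> y \<in> carrier G \<Longrightarrow> pow_le G x y \<longleftrightarrow> pow_le H (g x) (g y)"
    using assms(3) by (auto simp: rel_iso_def)
  have im: "carrier H = g ` carrier G" and inj: "inj_on g (carrier G)"
    using g by (auto simp: bij_betw_def)
  have cls: "g ` cyclic_class G x = cyclic_class H (g x)" if x: "x \<in> carrier G" for x
    unfolding G.cyclic_class_conv[OF x] H.cyclic_class_conv[OF bij_betw_apply[OF g x]]
    using iso x im by auto
  have sub: "S \<subseteq> carrier G" if "S \<in> cyclic_classes G" for S
    using that by (auto simp: cyclic_classes_def G.cyclic_class_iff)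
  have "(`) g ` cyclic_classes G = cyclic_classes H"
    unfolding cyclic_classes_def im by (auto simp: cls image_iff)
  moreover have "inj_on ((`) g) (cyclic_classes G)"
    using inj_on_image_eq_iff[OF inj] sub by (auto simp: inj_on_def)
  moreover have "le (quotient_poset G r) S T \<longleftrightarrow> le (quotient_poset H s) (g ` S) (g ` T)"
    if S: "S \<in> cyclic_classes G" and T: "T \<in> cyclic_classes G" for S T
  proof -
    obtain x where x: "x \<in> carrier G" "S = cyclic_class G x"
      using S by (auto simp: cyclic_classes_def)
    obtain y where y: "y \<in> carrier G" "T = cyclic_class G y"
      using T by (auto simp: cyclic_classes_def)
    show ?thesis
      unfolding x(2) y(2) cls[OF x(1)] cls[OF y(1)] G.quotient_le_iff[OF x(1) y(1)]
        H.quotient_le_iff[OF bij_betw_apply[OF g x(1)] bij_betw_apply[OF g y(1)]]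
      by (rule iso[OF x(1) y(1)])
  qed
  ultimately have "poset_isomorphism (quotient_poset G r) (quotient_poset H s) ((`) g)"
    by (auto simp: poset_isomorphism_def bij_betw_def quotient_poset_def)
  moreover have "card (g ` S) = card S" if "S \<in> cyclic_classes G" for S
    using inj_on_subset[OF inj sub[OF that]] by (rule card_image)
  ultimately show ?thesis by blast
qed

text \<open>The element of rank \<open>k\<close> in a class \<open>S\<close> goes to the element of
  rank \<open>k\<close> in \<open>\<tau> S\<close>. Since the classes have equal size, each pair of
  class and rank is taken equally often on both sides.\<close>

lemma cyc_poset_iso_if_quotient_iso:
  fixes G :: "('a, 'm) monoid_scheme" and H :: "('b, 'n) monoid_scheme"
  assumes "fin_group G" "fin_group H" and r: "class_ordering G r" and s: "class_ordering H s"
    and \<tau>: "poset_isomorphism (quotient_poset G r) (quotient_poset H s) \<tau>"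
    and card: "\<And>S. S \<in> cyclic_classes G \<Longrightarrow> card (\<tau> S) = card S"
  shows "rel_iso (carrier G) (le (cyc_poset G r)) (carrier H) (le (cyc_poset H s))"
proof -
  interpret G: fin_group G by fact
  interpret H: fin_group H by fact
  let ?rG = "\<lambda>x. order_rank (r (cyclic_class G x)) (cyclic_class G x) x"
  let ?rH = "\<lambda>x. order_rank (s (cyclic_class H x)) (cyclic_class H x) x"
  have bij: "bij_betw \<tau> (cyclic_classes G) (cyclic_classes H)"
    and iso: "\<And>S T. S \<in> cyclic_classes G \<Longrightarrow> T \<in> cyclic_classes G \<Longrightarrow>
      le (quotient_poset G r) S T \<longleftrightarrow> le (quotient_poset H s) (\<tau> S) (\<tau> T)"
    using \<tau> by (auto simp: poset_isomorphism_def quotient_poset_def)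
  have clG: "cyclic_class G x \<in> cyclic_classes G" if "x \<in> carrier G" for x
    using that by (auto simp: cyclic_classes_def)
  have memG: "cyclic_class G y = cyclic_class G x \<longleftrightarrow> y \<in> cyclic_class G x"
    if "x \<in> carrier G" "y \<in> carrier G" for x y
    using G.cyclic_class_eq_iff[OF that(2,1)] G.cyclic_class_conv[OF that(1)] that(2) by auto
  have memH: "cyclic_class H y = cyclic_class H x \<longleftrightarrow> y \<in> cyclic_class H x"
    if "x \<in> carrier H" "y \<in> carrier H" for x y
    using H.cyclic_class_eq_iff[OF that(2,1)] H.cyclic_class_conv[OF that(1)] that(2) by auto
  have inj: "\<tau> (cyclic_class G y) = \<tau> (cyclic_class G x) \<longleftrightarrow> cyclic_class G y = cyclic_class G x"
    if "x \<in> carrier G" "y \<in> carrier G" for x y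
    using bij_betw_imp_inj_on[OF bij] clG that by (auto simp: inj_on_def)
  show ?thesis
  proof (rule rel_iso_by_key[where \<kappa> = "\<lambda>x. (\<tau> (cyclic_class G x), ?rG x)"
        and \<mu> = "\<lambda>y. (cyclic_class H y, ?rH y)"])
    fix K :: "'b set \<times> nat"
    obtain T k where K: "K = (T, k)" by fastforce
    show "card {x \<in> carrier G. (\<tau> (cyclic_class G x), ?rG x) = K} =
      card {y \<in> carrier H. (cyclic_class H y, ?rH y) = K}"
    proof (cases "T \<in> cyclic_classes H")
      case True
      then obtain S where S: "S \<in> cyclic_classes G" "T = \<tau> S"
        using bij_betw_imp_surj_on[OF bij] by (metis imageE)
      obtain x where x: "x \<in> carrier G" "S = cyclic_class G x" using S by (auto simp: cyclic_classes_def)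
      obtain y where y: "y \<in> carrier H" "T = cyclic_class H y" using True by (auto simp: cyclic_classes_def)
      have "u \<in> carrier G \<and> (\<tau> (cyclic_class G u), ?rG u) = K \<longleftrightarrow> u \<in> S \<and> order_rank (r S) S u = k" for u
        unfolding K S(2) x(2) using memG[OF x(1), of u] inj[OF x(1), of u] G.cyclic_class_iff[OF x(1), of u]
        by auto
      then have 1: "{u \<in> carrier G. (\<tau> (cyclic_class G u), ?rG u) = K} = {u \<in> S. order_rank (r S) S u = k}"
        by blast
      have "u \<in> carrier H \<and> (cyclic_class H u, ?rH u) = K \<longleftrightarrow> u \<in> T \<and> order_rank (s T) T u = k" for u
        unfolding K y(2) using memH[OF y(1), of u] H.cyclic_class_iff[OF y(1), of u] by auto
      then have 2: "{u \<in> carrier H. (cyclic_class H u, ?rH u) = K} = {u \<in> T. order_rank (s T) T u = k}"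
        by blast
      have "linear_order_on S (r S)" "finite S" "linear_order_on T (s T)" "finite T"
        using G.class_linear_order[OF r x(1)] H.class_linear_order[OF s y(1)] x y by auto
      then show ?thesis unfolding 1 2 using card[OF S(1)] S(2) by (simp add: card_order_rank_eq)
    next
      case False
      have "\<tau> (cyclic_class G x) \<in> cyclic_classes H" if "x \<in> carrier G" for x
        using bij_betw_apply[OF bij clG[OF that]] .
      then have 1: "{x \<in> carrier G. (\<tau> (cyclic_class G x), ?rG x) = K} = {}"
        using False unfolding K by blast
      have 2: "{y \<in> carrier H. (cyclic_class H y, ?rH y) = K} = {}"
        using False unfolding K by (auto simp: cyclic_classes_def)
      show ?thesis unfolding 1 2 by simp
    qed
  next
    fix x y x' y'
    assume x: "x \<in> carrier G" and y: "y \<in> carrier G" and x': "x' \<in> carrier H" and y': "y' \<in> carrier H"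
      and kx: "(cyclic_class H x', ?rH x') = (\<tau> (cyclic_class G x), ?rG x)"
      and ky: "(cyclic_class H y', ?rH y') = (\<tau> (cyclic_class G y), ?rG y)"
    have "pow_le G x y \<longleftrightarrow> pow_le H x' y'"
      using iso[OF clG clG, OF x y] G.quotient_le_iff[OF x y, of r] H.quotient_le_iff[OF x' y', of s] kx ky
      by simp
    moreover have "cyclic_class H x' = cyclic_class H y' \<longleftrightarrow> cyclic_class G x = cyclic_class G y"
      using kx ky inj[OF y x] by simp
    moreover have "?rH x' = ?rG x" "?rH y' = ?rG y" using kx ky by blast+
    ultimately show "le (cyc_poset G r) x y \<longleftrightarrow> le (cyc_poset H s) x' y'"
      unfolding G.cyc_poset_le_iff[OF r x y] H.cyc_poset_le_iff[OF s x' y'] by (simp only:)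
  qed simp_all
qed

theorem theorem2p14:
  fixes G1 :: "('a, 'm) monoid_scheme" and G2 :: "('b, 'n) monoid_scheme"
    and r1 :: "'a set \<Rightarrow> 'a rel" and r2 :: "'b set \<Rightarrow> 'b rel"
  assumes "group G1" and "finite (carrier G1)"
    and "group G2" and "finite (carrier G2)"
    and "class_ordering G1 r1" and "class_ordering G2 r2"
  shows "(digraph_iso (with_proj (power_graph G1)) (with_proj (power_graph G2)) \<longleftrightarrow>
         digraph_iso (with_proj (power_digraph G1)) (with_proj (power_digraph G2))) \<and>
        (digraph_iso (with_proj (power_digraph G1)) (with_proj (power_digraph G2)) \<longleftrightarrow>
         digraph_iso (with_proj (order_digraph G1 r1)) (with_proj (order_digraph G2 r2))) \<and>
        (digraph_iso (with_proj (order_digraph G1 r1)) (with_proj (order_digraph G2 r2)) \<longleftrightarrow>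
         (\<exists>f. poset_isomorphism (cyc_poset G1 r1) (cyc_poset G2 r2) f)) \<and>
        ((\<exists>f. poset_isomorphism (cyc_poset G1 r1) (cyc_poset G2 r2) f) \<longleftrightarrow>
         (\<exists>\<tau>. poset_isomorphism (quotient_poset G1 r1) (quotient_poset G2 r2) \<tau> \<and>
              (\<forall>S \<in> cyclic_classes G1. card (\<tau> S) = card S)))"
proof -
  have fg: "fin_group G1" "fin_group G2"
    using assms by (auto simp: fin_group_def fin_group_axioms_def)
  interpret G: fin_group G1 by fact
  interpret H: fin_group G2 by fact
  let ?adj = "rel_iso (carrier G1) (pow_adj G1) (carrier G2) (pow_adj G2)"
  let ?le = "rel_iso (carrier G1) (pow_le G1) (carrier G2) (pow_le G2)"
  let ?cyc = "rel_iso (carrier G1) (le (cyc_poset G1 r1)) (carrier G2) (le (cyc_poset G2 r2))"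
  let ?quot = "\<exists>\<tau>. poset_isomorphism (quotient_poset G1 r1) (quotient_poset G2 r2) \<tau> \<and>
              (\<forall>S \<in> cyclic_classes G1. card (\<tau> S) = card S)"
  have i: "digraph_iso (with_proj (power_graph G1)) (with_proj (power_graph G2)) \<longleftrightarrow> ?adj"
    using G.power_graph_wf H.power_graph_wf
    by (rule digraph_iso_iff_rel_iso)
      (auto simp: G.power_graph_arc H.power_graph_arc power_graph_def[THEN arg_cong[of _ _ pverts]]
        dest: pow_adj_sym)
  have ii: "digraph_iso (with_proj (power_digraph G1)) (with_proj (power_digraph G2)) \<longleftrightarrow> ?le"
    using G.power_digraph_wf H.power_digraph_wf
    by (rule digraph_iso_iff_rel_iso)
      (auto simp: G.power_digraph_arc H.power_digraph_arc power_digraph_def[THEN arg_cong[of _ _ pverts]])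
  have iii: "digraph_iso (with_proj (order_digraph G1 r1)) (with_proj (order_digraph G2 r2)) \<longleftrightarrow> ?cyc"
    using G.order_digraph_wf H.order_digraph_wf
    by (rule digraph_iso_iff_rel_iso)
      (auto simp: G.order_digraph_arc H.order_digraph_arc order_digraph_def[THEN arg_cong[of _ _ pverts]]
        cyc_poset_def)
  have iv: "(\<exists>f. poset_isomorphism (cyc_poset G1 r1) (cyc_poset G2 r2) f) \<longleftrightarrow> ?cyc"
    by (simp add: poset_isomorphism_def rel_iso_def cyc_poset_def)
  have "?adj \<Longrightarrow> ?le" using pow_le_iso_if_pow_adj_iso[OF fg] .
  moreover have "?le \<Longrightarrow> ?quot" using quotient_iso_if_pow_le_iso[OF fg] .
  moreover have "?quot \<Longrightarrow> ?cyc" using cyc_poset_iso_if_quotient_iso[OF fg assms(5,6)] by blast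
  \<comment> \<open>This closes the circle: an isomorphism of the posets preserves comparability,
    which is adjacency in the power graph.\<close>
  moreover have "?cyc \<Longrightarrow> ?adj"
  proof -
    assume ?cyc
    then obtain f where f: "bij_betw f (carrier G1) (carrier G2)"
      and iso: "\<And>x y. x \<in> carrier G1 \<Longrightarrow> y \<in> carrier G1 \<Longrightarrow>
        le (cyc_poset G1 r1) x y \<longleftrightarrow> le (cyc_poset G2 r2) (f x) (f y)"
      by (auto simp: rel_iso_def)
    have "pow_adj G1 x y \<longleftrightarrow> pow_adj G2 (f x) (f y)" if "x \<in> carrier G1" "y \<in> carrier G1" for x y
      using G.pow_adj_iff_cyc_poset[OF assms(5) that]
        H.pow_adj_iff_cyc_poset[OF assms(6) bij_betw_apply[OF f that(1)] bij_betw_apply[OF f that(2)]]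
        iso[OF that] iso[OF that(2,1)] by simp
    then show ?adj using f by (auto simp: rel_iso_def)
  qed
  ultimately show ?thesis unfolding i ii iii iv by blast
qed

end
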